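(* For any $2n\times 2n$ complex symplectic matrix $S$, there exist a $2n\times 2n$ unitary symplectic matrix $U$ (a complex matrix that is both unitary and symplectic), an $n\times n$ complex invertible matrix $G$, and $n$ unique (up to order and signs) real numbers $\theta_1,\dots,\theta_n$ such that $$S=U\begin{bmatrix} Ch & Sh \\ Sh & Ch \end{bmatrix}\begin{bmatrix} G & 0 \\ 0 & G^{-T} \end{bmatrix}.$$ The transpose here is not the conjugate transpose.
   Context: A complex symplectic matrix is $S\in\mathbb{C}^{2n\times2n}$ with $S^TJ_nS=J_n$, where $J_n=\begin{bmatrix} 0 & I_n \\ -I_n & 0 \end{bmatrix}$ and $^T$ is the ordinary (non-conjugate) transpose. $G^{-T}=(G^{-1})^T$. $Ch=\operatorname{diag}(\cosh\theta_1,\dots,\cosh\theta_n)$ and $Sh=\operatorname{diag}(\sinh\theta_1,\dots,\sinh\theta_n)$. *)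

theory Defs
  imports
    Complex_Main
    "HOL-Combinatorics.Permutations"
    "Jordan_Normal_Form.Schur_Decomposition"
    "Jordan_Normal_Form.Gauss_Jordan_Elimination"
    "Jordan_Normal_Form.Determinant"
begin

definition symp_J :: "nat \<Rightarrow> complex mat" where
  "symp_J n = four_block_mat (0\<^sub>m n n) (1\<^sub>m n) (- 1\<^sub>m n) (0\<^sub>m n n)"

(* The transpose is not conjugated, so this is the group Sp(2n, C). *)
definition symplectic_mat :: "nat \<Rightarrow> complex mat \<Rightarrow> bool" where
  "symplectic_mat n S \<longleftrightarrow>
     S \<in> carrier_mat (2 * n) (2 * n) \<and> S\<^sup>T * symp_J n * S = symp_J n"

definition unitary_mat :: "nat \<Rightarrow> complex mat \<Rightarrow> bool" where
  "unitary_mat m U \<longleftrightarrow> U \<in> carrier_mat m m \<and> mat_adjoint U * U = 1\<^sub>m m"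

(* Only meaningful for invertible matrices; see mat_inv_correct. *)
definition mat_inv :: "complex mat \<Rightarrow> complex mat" where
  "mat_inv G = the (mat_inverse G)"

definition Ch :: "nat \<Rightarrow> (nat \<Rightarrow> real) \<Rightarrow> complex mat" where
  "Ch n \<theta> = mat_diag n (\<lambda>i. complex_of_real (cosh (\<theta> i)))"

definition Sh :: "nat \<Rightarrow> (nat \<Rightarrow> real) \<Rightarrow> complex mat" where
  "Sh n \<theta> = mat_diag n (\<lambda>i. complex_of_real (sinh (\<theta> i)))"

(* The parameters are theta 0, ..., theta (n - 1); values at indices >= n are irrelevant. *)
definition hyp_decomp ::
  "nat \<Rightarrow> complex mat \<Rightarrow> complex mat \<Rightarrow> complex mat \<Rightarrow> (nat \<Rightarrow> real) \<Rightarrow> bool" where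
  "hyp_decomp n S U G \<theta> \<longleftrightarrow>
     unitary_mat (2 * n) U \<and> symplectic_mat n U \<and>
     G \<in> carrier_mat n n \<and> invertible_mat G \<and>
     S = U * four_block_mat (Ch n \<theta>) (Sh n \<theta>) (Sh n \<theta>) (Ch n \<theta>)
           * four_block_mat G (0\<^sub>m n n) (0\<^sub>m n n) ((mat_inv G)\<^sup>T)"

definition eq_up_to_order_and_signs :: "nat \<Rightarrow> (nat \<Rightarrow> real) \<Rightarrow> (nat \<Rightarrow> real) \<Rightarrow> bool" where
  "eq_up_to_order_and_signs n \<theta> \<theta>' \<longleftrightarrow>
     (\<exists>\<pi> s. \<pi> permutes {..<n} \<and>
        (\<forall>i<n. s i \<in> {-1, 1} \<and> \<theta>' i = s i * \<theta> (\<pi> i)))"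

lemma mat_inv_correct:
  assumes G: "G \<in> carrier_mat n n" and inv: "invertible_mat G"
  shows "mat_inv G \<in> carrier_mat n n" "G * mat_inv G = 1\<^sub>m n" "mat_inv G * G = 1\<^sub>m n"
proof -
  from inv obtain B where B: "G * B = 1\<^sub>m n" "B * G = 1\<^sub>m (dim_row B)"
    using G unfolding invertible_mat_def inverts_mat_def by auto
  have dB: "B \<in> carrier_mat n n"
  proof (rule carrier_matI)
    have "dim_row B = dim_col (B * G)" using B(2) by simp
    then show "dim_row B = n" using G by simp
    have "dim_col (G * B) = n" using B(1) by simp
    then show "dim_col B = n" by simp
  qed
  have "G \<in> Units (ring_mat TYPE(complex) n ())"
    using G B dB by (auto simp: Units_def ring_mat_def)
  then obtain C where C: "mat_inverse G = Some C"
    using mat_inverse(1)[OF G, of "()"] by (cases "mat_inverse G") auto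
  show "mat_inv G \<in> carrier_mat n n" "G * mat_inv G = 1\<^sub>m n" "mat_inv G * G = 1\<^sub>m n"
    using mat_inverse(2)[OF G C] C by (simp_all add: mat_inv_def)
qed

end

(* Put L = diag(I, -I). Since block-diagonal factors commute with L, a decomposition S = U A D
   forces M = S L S^-1 = U A^2 L U^*, hence M + M^* = U diag(2 cosh 2 theta, -2 cosh 2 theta) U^*,
   and the spectrum of M + M^* determines the theta's up to order and sign.
   Conversely, M is an involution in the symplectic Lie algebra, and with j a = J conj(a) one has
   M^* j = - j M. The Hermitian part H = M + M^* and the skew part K = M - M^* anticommute and
   H^2 + K^2 = 4. On an eigenspace of H the map a -> j (K a) is antilinear with square
   s^2 >= 0, so it has an eigenvector x with eigenvalue s, and span {x, j x} is then invariant
   under M and M^*. Splitting off such planes one after the other gives a unitary symplectic V with M V = V A^2 L, and then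
   A^-1 V^* S commutes with L, so it is block diagonal. *)
theory Submission
  imports Defs
begin

text \<open>The symplectic matrices commuting with L are exactly the factors diag(G, G^-T), so S L
  S^-1 determines S up to such a right factor. The claim thus becomes a normal form for one
  involution under unitary symplectic conjugation. The obstacle is that a unitary diagonalisation of
  M + M^* is not enough: the basis must also respect J, even inside multiple eigenspaces. A unitary
  matrix is symplectic exactly when it commutes with j, so the basis has to consist of pairs x, - j
  x. The map a -> j (K a) preserves the eigenspaces of H because both j and K anticommute with H.
  Since it is antilinear, multiplication by the imaginary unit exchanges its eigenvalues s and -s,
  so the sign can be prescribed. Positivity supplies the hyperbolic angles: K is skew, so |K a|^2 =
  (r^2 - 4) |a|^2 on the r-eigenspace of H. This forces r^2 >= 4, and with s^2 = r^2 - 4 the numbers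
  r / 2 and s / 2 are cosh and sinh of a common angle 2 \<theta>.\<close>

section \<open>Eigenvectors in invariant subspaces\<close>

text \<open>The m + 1 vectors w, A w, ..., A^m w lie in dimension m and are therefore dependent.
  Stating the relation coordinatewise avoids finite sums of vectors.\<close>

lemma exists_krylov_relation:
  fixes A :: "complex mat"
  assumes A: "A \<in> carrier_mat m m" and w: "w \<in> carrier_vec m"
  obtains p :: "complex poly" where "p \<noteq> 0"
    "\<And>i. i < m \<Longrightarrow> (\<Sum>k\<le>degree p. coeff p k * (A ^\<^sub>m k *\<^sub>v w) $ i) = 0"
proof -
  \<comment> \<open>The additional zero row makes the system square, so that a vanishing determinant
    yields a nonzero kernel vector.\<close>
  define C where "C = mat (Suc m) (Suc m) (\<lambda>(i,k). if i < m then (A ^\<^sub>m k *\<^sub>v w) $ i else 0)"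
  have C: "C \<in> carrier_mat (Suc m) (Suc m)" by (simp add: C_def)
  have "C = mat\<^sub>r (Suc m) (Suc m) (\<lambda>i. if i = m then 0\<^sub>v (Suc m) else row C i)"
    by (rule eq_matI) (auto simp: C_def)
  then have "det C = 0"
    using det_row_0[of m "Suc m" "row C"] C by simp
  then obtain c where c: "c \<in> carrier_vec (Suc m)" "c \<noteq> 0\<^sub>v (Suc m)" "C *\<^sub>v c = 0\<^sub>v (Suc m)"
    using det_0_iff_vec_prod_zero[OF C] by auto
  define p where "p = Poly (list_of_vec c)"
  have cf: "coeff p k = (if k < Suc m then c $ k else 0)" for k
    using c(1) by (auto simp: p_def nth_default_def list_of_vec_index)
  show ?thesis
  proof (rule that)
    obtain k where "k < Suc m" "c $ k \<noteq> 0" using c(1,2) by (metis eq_vecI carrier_vecD index_zero_vec)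
    then show "p \<noteq> 0" using cf[of k] by auto
    have deg: "degree p \<le> m" by (rule degree_le) (simp add: cf)
    fix i assume i: "i < m"
    have "(\<Sum>k\<le>degree p. coeff p k * (A ^\<^sub>m k *\<^sub>v w) $ i) = (\<Sum>k\<le>m. coeff p k * (A ^\<^sub>m k *\<^sub>v w) $ i)"
      by (rule sum.mono_neutral_left) (use deg in \<open>auto intro: coeff_eq_0\<close>)
    also have "\<dots> = (C *\<^sub>v c) $ i"
      using i c(1) C by (auto simp: C_def cf scalar_prod_def atLeast0LessThan lessThan_Suc_atMost mult.commute intro!: sum.cong)
    finally show "(\<Sum>k\<le>degree p. coeff p k * (A ^\<^sub>m k *\<^sub>v w) $ i) = 0" using c i by simp
  qed
qed

text \<open>Neither a basis of \<open>W\<close> nor a restriction of \<open>A\<close> is needed: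
  take a nonzero p with p(A) w = 0 and split off a root, p = (X - r) q. Either q(A) w = 0 and the
  degree has dropped, or q(A) w is an eigenvector for r, which lies in \<open>W\<close> by
  invariance.\<close>

lemma eigenvector_in_invariant_subspace:
  fixes A :: "complex mat"
  assumes A: "A \<in> carrier_mat m m" and W: "W \<subseteq> carrier_vec m"
    and add: "\<And>a b. a \<in> W \<Longrightarrow> b \<in> W \<Longrightarrow> a + b \<in> W"
    and smult: "\<And>c a. a \<in> W \<Longrightarrow> c \<cdot>\<^sub>v a \<in> W"
    and inv: "\<And>a. a \<in> W \<Longrightarrow> A *\<^sub>v a \<in> W"
    and w: "w \<in> W" "w \<noteq> 0\<^sub>v m"
  obtains v r where "v \<in> W" "v \<noteq> 0\<^sub>v m" "A *\<^sub>v v = r \<cdot>\<^sub>v v"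
proof -
  have wc: "w \<in> carrier_vec m" using w W by auto
  \<comment> \<open>This is p(A) w, evaluated by Horner's scheme on the coefficient list.\<close>
  define pv where "pv p = fold_coeffs (\<lambda>a v. a \<cdot>\<^sub>v w + A *\<^sub>v v) p (0\<^sub>v m)" for p
  have pv0 [simp]: "pv 0 = 0\<^sub>v m" by (simp add: pv_def)
  have pvC [simp]: "pv (pCons a p) = a \<cdot>\<^sub>v w + A *\<^sub>v pv p" for a p
  \<comment> \<open>Only for \<open>pCons 0 0\<close> does the coefficient list not start with
    \<open>a\<close>; there both sides are the zero vector.\<close>
  proof (cases "a = 0 \<and> p = 0")
    case True
    then show ?thesis using A wc by auto
  next
    case False
    then have "coeffs (pCons a p) = a # coeffs p" by (auto simp: cCons_def)
    then show ?thesis by (simp add: pv_def fold_coeffs_def)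
  qed
  have "0 \<cdot>\<^sub>v w = 0\<^sub>v m" using wc by auto
  then have W0: "0\<^sub>v m \<in> W" using smult[OF w(1), of 0] by simp
  have pvW: "pv p \<in> W" for p
    by (induction p) (auto simp: W0 intro!: add smult inv w)
  then have pvc [simp]: "pv p \<in> carrier_vec m" for p using W by blast
  have dA [simp]: "dim_row A = m" "dim_col A = m" and dw [simp]: "dim_vec w = m"
    and dpv [simp]: "dim_vec (pv p) = m" for p
    using A wc pvc[of p] by auto
  have pvadd: "pv (p + q) = pv p + pv q" for p q
  proof (induction p q rule: poly_induct2)
    case (pCons a p b q)
    have "A *\<^sub>v (pv p + pv q) = A *\<^sub>v pv p + A *\<^sub>v pv q" by (rule mult_add_distrib_mat_vec[OF A]) auto
    with pCons show ?case by (intro eq_vecI) (auto simp: algebra_simps)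
  qed simp
  have pvsm: "pv (Polynomial.smult c p) = c \<cdot>\<^sub>v pv p" for c p
  proof (induction p)
    case (pCons a p)
    have "A *\<^sub>v (c \<cdot>\<^sub>v pv p) = c \<cdot>\<^sub>v (A *\<^sub>v pv p)" by (rule mult_mat_vec[OF A]) auto
    with pCons show ?case by (intro eq_vecI) (auto simp: algebra_simps)
  qed (auto intro: eq_vecI)
  have pvlin: "pv ([:-r, 1:] * q) = A *\<^sub>v pv q - r \<cdot>\<^sub>v pv q" for r q
  proof -
    have "[:-r, 1:] * q = Polynomial.smult (-r) q + pCons 0 q" by simp
    then have "pv ([:-r, 1:] * q) = (-r) \<cdot>\<^sub>v pv q + (0 \<cdot>\<^sub>v w + A *\<^sub>v pv q)" by (simp only: pvadd pvsm pvC)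
    also have "\<dots> = A *\<^sub>v pv q - r \<cdot>\<^sub>v pv q" by (intro eq_vecI) auto
    finally show ?thesis .
  qed
  have pvi: "pv p $ i = (\<Sum>k\<le>degree p. coeff p k * (A ^\<^sub>m k *\<^sub>v w) $ i)" if "i < m" for p i
    using that
  proof (induction p arbitrary: i)
    case (pCons a p)
    show ?case
    proof (cases "p = 0")
      case True
      then show ?thesis using pCons wc A by simp
    next
      case False
      have pw: "A ^\<^sub>m k \<in> carrier_mat m m" for k using A by simp
      \<comment> \<open>\<open>pow_mat\<close> appends its new factor on the right, whereas Horner's
        scheme multiplies by \<open>A\<close> on the left.\<close>
      have comm: "A ^\<^sub>m Suc k *\<^sub>v w = A *\<^sub>v (A ^\<^sub>m k *\<^sub>v w)" for k
      proof -
        have "A ^\<^sub>m Suc k = A * A ^\<^sub>m k"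
          by (induction k) (use A pw in \<open>auto simp: assoc_mult_mat[OF A pw A]\<close>)
        then show ?thesis using A pw wc by (metis assoc_mult_mat_vec)
      qed
      have "(A *\<^sub>v pv p) $ i = (\<Sum>j<m. A $$ (i,j) * (\<Sum>k\<le>degree p. coeff p k * (A ^\<^sub>m k *\<^sub>v w) $ j))"
        using pCons.prems by (auto simp: scalar_prod_def atLeast0LessThan pCons.IH intro!: sum.cong)
      also have "\<dots> = (\<Sum>k\<le>degree p. coeff p k * (\<Sum>j<m. A $$ (i,j) * (A ^\<^sub>m k *\<^sub>v w) $ j))"
        unfolding sum_distrib_left by (subst sum.swap) (simp add: mult_ac)
      also have "\<dots> = (\<Sum>k\<le>degree p. coeff p k * (A ^\<^sub>m Suc k *\<^sub>v w) $ i)"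
        unfolding comm using pCons.prems pw
        by (intro sum.cong) (auto simp: scalar_prod_def atLeast0LessThan carrier_matD[OF pw] intro!: sum.cong)
      finally show ?thesis using False pCons.prems wc A
        by (simp del: pow_mat.simps(2) sum.atMost_Suc add: sum.atMost_Suc_shift)
    qed
  qed simp
  have main: "\<exists>v r. v \<in> W \<and> v \<noteq> 0\<^sub>v m \<and> A *\<^sub>v v = r \<cdot>\<^sub>v v" if "p \<noteq> 0" "pv p = 0\<^sub>v m" for p
    using that
  proof (induction "degree p" arbitrary: p)
    case 0
    then obtain a where p: "p = [:a:]" "a \<noteq> 0" by (metis degree_eq_zeroE pCons_0_0)
    have "pv p = a \<cdot>\<^sub>v w" using p wc A by (intro eq_vecI) auto
    then have "w $ i = 0" if "i < m" for i
      using 0 p that by (metis dw index_smult_vec(1) index_zero_vec(1) mult_eq_0_iff)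
    then have "w = 0\<^sub>v m" by (intro eq_vecI) auto
    then show ?case using w by simp
  next
    case (Suc d)
    then obtain r where "poly p r = 0"
      using fundamental_theorem_of_algebra[of p] constant_degree[of p] by auto
    then obtain q where q: "p = [:-r, 1:] * q" using poly_eq_0_iff_dvd by blast
    show ?case
    proof (cases "pv q = 0\<^sub>v m")
      case True
      have "q \<noteq> 0" using q Suc by auto
      then have "degree p = Suc (degree q)" using q degree_mult_eq[of "[:-r, 1:]" q] by simp
      then show ?thesis using Suc True \<open>q \<noteq> 0\<close> by auto
    next
      case False
      have eq: "A *\<^sub>v pv q - r \<cdot>\<^sub>v pv q = 0\<^sub>v m" using Suc q pvlin by simp
      have "A *\<^sub>v pv q = r \<cdot>\<^sub>v pv q"
      proof (rule eq_vecI)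
        fix i assume "i < dim_vec (r \<cdot>\<^sub>v pv q)"
        then show "(A *\<^sub>v pv q) $ i = (r \<cdot>\<^sub>v pv q) $ i"
          using arg_cong[OF eq, of "\<lambda>v. v $ i"] by simp
      qed simp
      then show ?thesis using False pvW by blast
    qed
  qed
  obtain p where p: "p \<noteq> 0" "\<And>i. i < m \<Longrightarrow> (\<Sum>k\<le>degree p. coeff p k * (A ^\<^sub>m k *\<^sub>v w) $ i) = 0"
    using exists_krylov_relation[OF A wc] by blast
  have "pv p = 0\<^sub>v m" by (intro eq_vecI) (simp_all add: pvi p(2) del: index_mult_mat_vec)
  from main[OF p(1) this] that show ?thesis by blast
qed

section \<open>Involutions with a quaternionic structure\<close>

lemma cscalar_add_left:
  fixes a b c :: "complex vec"
  assumes "a \<in> carrier_vec m" "b \<in> carrier_vec m" "c \<in> carrier_vec m"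
  shows "(a + b) \<bullet>c c = a \<bullet>c c + b \<bullet>c c"
  using assms by (intro add_scalar_prod_distrib) auto

lemma cscalar_add_right:
  fixes a b c :: "complex vec"
  assumes "a \<in> carrier_vec m" "b \<in> carrier_vec m" "c \<in> carrier_vec m"
  shows "c \<bullet>c (a + b) = c \<bullet>c a + c \<bullet>c b"
  using assms conjugate_add_vec[of a m b] scalar_prod_add_distrib[of c m "conjugate a" "conjugate b"] by simp

lemma cscalar_smult_left:
  fixes a c :: "complex vec"
  assumes "a \<in> carrier_vec m" "c \<in> carrier_vec m"
  shows "(r \<cdot>\<^sub>v a) \<bullet>c c = r * (a \<bullet>c c)"
  using assms by simp

lemma cscalar_smult_right:
  fixes a c :: "complex vec"
  assumes "a \<in> carrier_vec m" "c \<in> carrier_vec m"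
  shows "c \<bullet>c (r \<cdot>\<^sub>v a) = cnj r * (c \<bullet>c a)"
  using assms by (simp add: conjugate_smult_vec)

lemma cscalar_commute:
  fixes a b :: "complex vec"
  assumes "a \<in> carrier_vec m" "b \<in> carrier_vec m"
  shows "a \<bullet>c b = cnj (b \<bullet>c a)"
  using assms conjugate_conjugate_sprod[of b m a] conjugate_vec_sprod_comm[of a m b]
  by (metis carrier_vec_conjugate conjugate_complex_def conjugate_conjugate_sprod conjugate_id conjugate_vec_sprod_comm)

text \<open>Orthogonality to d vectors is a system of d linear equations. Because d < m, padding it
  to m rows leaves at least the zero row \<open>d\<close>, so the square system is singular.\<close>

lemma exists_orthogonal_vector:
  fixes u :: "nat \<Rightarrow> complex vec"
  assumes "d < m" "\<And>i. i < d \<Longrightarrow> u i \<in> carrier_vec m"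
  obtains w where "w \<in> carrier_vec m" "w \<noteq> 0\<^sub>v m" "\<And>i. i < d \<Longrightarrow> w \<bullet>c u i = 0"
proof -
  define C where "C = mat\<^sub>r m m (\<lambda>i. if i = d then 0\<^sub>v m else if i < d then conjugate (u i) else 0\<^sub>v m)"
  have C: "C \<in> carrier_mat m m" by (simp add: C_def)
  have "det C = 0" unfolding C_def by (rule det_row_0) (use assms in auto)
  then obtain w where w: "w \<in> carrier_vec m" "w \<noteq> 0\<^sub>v m" "C *\<^sub>v w = 0\<^sub>v m"
    using det_0_iff_vec_prod_zero[OF C] by auto
  have "w \<bullet>c u i = 0" if i: "i < d" for i
  proof -
    have "row C i = conjugate (u i)" using i assms by (auto simp: C_def)
    then have "conjugate (u i) \<bullet> w = 0"
      using arg_cong[OF w(3), of "\<lambda>v. v $ i"] i assms(1) C by simp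
    then show ?thesis using conjugate_vec_sprod_comm[OF w(1) assms(2)[OF i]] by simp
  qed
  with w that show ?thesis by blast
qed

text \<open>This isolates what the reduction uses of J: \<open>j\<close> is antiunitary with square
  -1, a quaternionic structure. Here \<open>N\<close> is the adjoint of \<open>M\<close>, and
  \<open>N_j\<close> is the Lie algebra condition M^T J = - J M after entrywise conjugation.\<close>

locale quaternionic_involution =
  fixes m :: nat and M N :: "complex mat" and j :: "complex vec \<Rightarrow> complex vec"
  assumes M [simp]: "M \<in> carrier_mat m m" and N [simp]: "N \<in> carrier_mat m m"
    and adjoint: "\<And>a b. a \<in> carrier_vec m \<Longrightarrow> b \<in> carrier_vec m \<Longrightarrow> (M *\<^sub>v a) \<bullet>c b = a \<bullet>c (N *\<^sub>v b)"
    and j_carrier [simp]: "\<And>a. a \<in> carrier_vec m \<Longrightarrow> j a \<in> carrier_vec m"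
    and j_add: "\<And>a b. a \<in> carrier_vec m \<Longrightarrow> b \<in> carrier_vec m \<Longrightarrow> j (a + b) = j a + j b"
    and j_smult: "\<And>c a. a \<in> carrier_vec m \<Longrightarrow> j (c \<cdot>\<^sub>v a) = cnj c \<cdot>\<^sub>v j a"
    and j_j: "\<And>a. a \<in> carrier_vec m \<Longrightarrow> j (j a) = - a"
    and j_cscalar: "\<And>a b. a \<in> carrier_vec m \<Longrightarrow> b \<in> carrier_vec m \<Longrightarrow> j a \<bullet>c j b = cnj (a \<bullet>c b)"
    and N_j: "\<And>a. a \<in> carrier_vec m \<Longrightarrow> N *\<^sub>v j a = - j (M *\<^sub>v a)"
    and M_M: "\<And>a. a \<in> carrier_vec m \<Longrightarrow> M *\<^sub>v (M *\<^sub>v a) = a"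
begin

definition invariant :: "complex vec set \<Rightarrow> bool" where
  "invariant W \<longleftrightarrow> W \<subseteq> carrier_vec m \<and> (\<forall>a\<in>W. \<forall>b\<in>W. a + b \<in> W) \<and>
     (\<forall>a\<in>W. (\<forall>c. c \<cdot>\<^sub>v a \<in> W) \<and> M *\<^sub>v a \<in> W \<and> N *\<^sub>v a \<in> W \<and> j a \<in> W)"

lemma M_carrier [simp]: "a \<in> carrier_vec m \<Longrightarrow> M *\<^sub>v a \<in> carrier_vec m"
  and N_carrier [simp]: "a \<in> carrier_vec m \<Longrightarrow> N *\<^sub>v a \<in> carrier_vec m"
  using mult_mat_vec_carrier[OF M] mult_mat_vec_carrier[OF N] by auto

lemma dim_simps [simp]: "a \<in> carrier_vec m \<Longrightarrow> dim_vec (j a) = m"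
  "dim_row M = m" "dim_row N = m" "dim_col M = m" "dim_col N = m"
  using carrier_vecD[OF j_carrier] carrier_matD[OF M] carrier_matD[OF N] by auto

lemma linear_simps:
  "a \<in> carrier_vec m \<Longrightarrow> b \<in> carrier_vec m \<Longrightarrow> M *\<^sub>v (a + b) = M *\<^sub>v a + M *\<^sub>v b"
  "a \<in> carrier_vec m \<Longrightarrow> b \<in> carrier_vec m \<Longrightarrow> N *\<^sub>v (a + b) = N *\<^sub>v a + N *\<^sub>v b"
  "a \<in> carrier_vec m \<Longrightarrow> M *\<^sub>v (c \<cdot>\<^sub>v a) = c \<cdot>\<^sub>v (M *\<^sub>v a)"
  "a \<in> carrier_vec m \<Longrightarrow> N *\<^sub>v (c \<cdot>\<^sub>v a) = c \<cdot>\<^sub>v (N *\<^sub>v a)"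
  using mult_add_distrib_mat_vec[OF M] mult_add_distrib_mat_vec[OF N]
    mult_mat_vec[OF M] mult_mat_vec[OF N] by auto

lemma uminus_conv: "a \<in> carrier_vec m \<Longrightarrow> - a = (-1) \<cdot>\<^sub>v (a :: complex vec)"
  by (intro eq_vecI) auto

lemma j_uminus: "a \<in> carrier_vec m \<Longrightarrow> j (- a) = - j a"
  by (simp add: uminus_conv j_smult)

lemma M_j: assumes "a \<in> carrier_vec m" shows "M *\<^sub>v j a = - j (N *\<^sub>v a)"
proof -
  have "N *\<^sub>v a = - (N *\<^sub>v j (j a))"
    using assms by (simp add: j_j uminus_conv linear_simps smult_smult_assoc)
  also have "\<dots> = j (M *\<^sub>v j a)"
    using assms by (simp add: N_j uminus_conv smult_smult_assoc)
  finally have "j (N *\<^sub>v a) = - (M *\<^sub>v j a)" using assms by (simp add: j_j)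
  then show ?thesis by simp
qed

lemma adjoint': 
  assumes "a \<in> carrier_vec m" "b \<in> carrier_vec m"
  shows "(N *\<^sub>v a) \<bullet>c b = a \<bullet>c (M *\<^sub>v b)"
  using adjoint[of b a] cscalar_commute[of "N *\<^sub>v a" m b] cscalar_commute[of a m "M *\<^sub>v b"] assms
  by simp

text \<open>The adjoint of M^2 = 1: the difference N^2 a - a is orthogonal to every vector, hence to
  itself.\<close>

lemma N_N: assumes "a \<in> carrier_vec m" shows "N *\<^sub>v (N *\<^sub>v a) = a"
proof -
  let ?d = "N *\<^sub>v (N *\<^sub>v a) + (-1) \<cdot>\<^sub>v a"
  have *: "(N *\<^sub>v (N *\<^sub>v a)) \<bullet>c b = a \<bullet>c b" if "b \<in> carrier_vec m" for b
    using that assms by (simp add: adjoint' M_M)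
  have c: "?d \<in> carrier_vec m" using assms by simp
  have "?d \<bullet>c ?d = (N *\<^sub>v (N *\<^sub>v a)) \<bullet>c ?d + (-1) * (a \<bullet>c ?d)"
    using c assms by (subst cscalar_add_left[of _ m]) (auto simp: cscalar_smult_left[of _ m])
  also have "\<dots> = 0" using *[OF c] by simp
  finally have d: "?d = 0\<^sub>v m" using conjugate_square_eq_0_vec[OF c] by simp
  show ?thesis
  proof (rule eq_vecI)
    fix i assume "i < dim_vec a"
    then show "(N *\<^sub>v (N *\<^sub>v a)) $ i = a $ i" using arg_cong[OF d, of "\<lambda>v. v $ i"] assms by simp
  qed (use assms in auto)
qed

lemma cscalar_j_left:
  assumes "a \<in> carrier_vec m" "b \<in> carrier_vec m"
  shows "j a \<bullet>c b = - cnj (a \<bullet>c j b)"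
proof -
  have "b = - j (j b)" using assms by (simp add: j_j)
  then have "j a \<bullet>c b = - (j a \<bullet>c j (j b))"
    using assms cscalar_smult_right[of "j (j b)" m "j a" "-1"] by (simp add: uminus_conv)
  then show ?thesis using assms by (simp add: j_cscalar)
qed

text \<open>Antiunitarity and j^2 = -1 make the product equal to its own negative. Hence x and j x
  always span a genuine plane when x is nonzero.\<close>

lemma cscalar_j_self: assumes "a \<in> carrier_vec m" shows "a \<bullet>c j a = 0"
proof -
  have "j a \<bullet>c a = - (j a \<bullet>c a)"
    using cscalar_j_left[OF assms assms] cscalar_commute[of "j a" m a] assms by simp
  then have "j a \<bullet>c a = 0" by simp
  then show ?thesis using cscalar_commute[of a m "j a"] assms by simp
qed


text \<open>It suffices to find x with (M + N) x = r x and j ((M - N) x) = s x: half sums and half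
  differences then give M x and N x, so the constants of the conclusion are r / 2 and s / 2. Working
  inside \<open>W\<close> is what makes the later induction possible.\<close>

lemma exists_adapted_vector:
  assumes W: "invariant W" and w: "w \<in> W" "w \<noteq> 0\<^sub>v m"
  obtains x and c s :: real where "x \<in> W" "x \<bullet>c x = 1" "c \<ge> 1" "c\<^sup>2 - s\<^sup>2 = 1"
    "M *\<^sub>v x = complex_of_real c \<cdot>\<^sub>v x - complex_of_real s \<cdot>\<^sub>v j x"
    "N *\<^sub>v x = complex_of_real c \<cdot>\<^sub>v x + complex_of_real s \<cdot>\<^sub>v j x"
proof -
  have Wc: "a \<in> carrier_vec m" and Wj: "j a \<in> W" and WM: "M *\<^sub>v a \<in> W" and WN: "N *\<^sub>v a \<in> W"
    and Wsm: "b \<cdot>\<^sub>v a \<in> W" if "a \<in> W" for a b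
    using W that unfolding invariant_def by auto
  have Wadd: "a + b \<in> W" if "a \<in> W" "b \<in> W" for a b
    using W that unfolding invariant_def by auto
  define K where "K a = M *\<^sub>v a + (-1) \<cdot>\<^sub>v (N *\<^sub>v a)" for a
  have WK: "K a \<in> W" if "a \<in> W" for a
    unfolding K_def using that by (intro Wadd Wsm WM WN)
  have MN_apply: "(M + N) *\<^sub>v a = M *\<^sub>v a + N *\<^sub>v a" if "a \<in> carrier_vec m" for a
    using that by (rule add_mult_distrib_mat_vec[OF M N])
  obtain v0 r0 where v0: "v0 \<in> W" "v0 \<noteq> 0\<^sub>v m" "(M + N) *\<^sub>v v0 = r0 \<cdot>\<^sub>v v0"
  proof (rule eigenvector_in_invariant_subspace[of "M + N" m W w])
    show "(M + N) *\<^sub>v a \<in> W" if "a \<in> W" for a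
      using that by (simp add: MN_apply Wc Wadd WM WN)
  qed (use w Wc Wadd Wsm in auto)
  note index_mult_mat_vec [simp del]
  have v0c [simp]: "v0 \<in> carrier_vec m" using v0 Wc by blast
  then have [simp]: "dim_vec v0 = m" by (rule carrier_vecD)
  have sum0: "M *\<^sub>v v0 + N *\<^sub>v v0 = r0 \<cdot>\<^sub>v v0" using v0(3) by (simp add: MN_apply)
  have nz: "v0 \<bullet>c v0 \<noteq> 0" using v0(2) conjugate_square_eq_0_vec[OF v0c] by simp
  \<comment> \<open>\<open>M + N\<close> is self-adjoint, so its eigenvalue is real.\<close>
  have "r0 * (v0 \<bullet>c v0) = (M *\<^sub>v v0 + N *\<^sub>v v0) \<bullet>c v0" by (simp add: sum0 cscalar_smult_left)
  also have "\<dots> = v0 \<bullet>c (M *\<^sub>v v0 + N *\<^sub>v v0)"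
    by (simp add: cscalar_add_left[of _ m] cscalar_add_right[of _ m] adjoint adjoint')
  also have "\<dots> = cnj r0 * (v0 \<bullet>c v0)" by (simp add: sum0 cscalar_smult_right[of _ m])
  finally have "r0 = cnj r0" using nz by simp
  then obtain q where q: "r0 = complex_of_real q" by (metis Reals_cases Reals_cnj_iff)
  \<comment> \<open>\<open>j\<close> anticommutes with \<open>M + N\<close> and so exchanges the
    eigenvalues q and -q. Choosing the nonnegative one is what later gives c >= 1.\<close>
  define v where "v = (if q \<ge> 0 then v0 else j v0)"
  define r where "r = \<bar>q\<bar>"
  have vW: "v \<in> W" using v0 Wj by (simp add: v_def)
  have vc [simp]: "v \<in> carrier_vec m" using vW Wc by blast
  then have [simp]: "dim_vec v = m" by (rule carrier_vecD)
  have jv0: "j v0 \<bullet>c j v0 = cnj (v0 \<bullet>c v0)" by (simp add: j_cscalar)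
  have vnz: "v \<bullet>c v \<noteq> 0" using nz jv0 by (auto simp: v_def)
  have sumv: "M *\<^sub>v v + N *\<^sub>v v = complex_of_real r \<cdot>\<^sub>v v"
  proof (cases "q \<ge> 0")
    case False
    have "M *\<^sub>v j v0 + N *\<^sub>v j v0 = - j (M *\<^sub>v v0 + N *\<^sub>v v0)"
      by (simp add: M_j N_j j_add) (intro eq_vecI, auto)
    also have "\<dots> = (- complex_of_real q) \<cdot>\<^sub>v j v0"
      by (simp add: sum0 j_smult q) (intro eq_vecI, auto)
    finally show ?thesis using False by (simp add: v_def r_def)
  qed (simp add: v_def r_def sum0 q)
  have idx: "(M *\<^sub>v v) $ i + (N *\<^sub>v v) $ i = complex_of_real r * v $ i" if "i < m" for i
    using arg_cong[OF sumv, of "\<lambda>v. v $ i"] that by simp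
  let ?MN = "M *\<^sub>v (N *\<^sub>v v)" and ?NM = "N *\<^sub>v (M *\<^sub>v v)"
  have Nv: "N *\<^sub>v v = complex_of_real r \<cdot>\<^sub>v v + (-1) \<cdot>\<^sub>v (M *\<^sub>v v)"
    using idx by (intro eq_vecI) (simp_all add: algebra_simps)
  then have Mv: "M *\<^sub>v v = complex_of_real r \<cdot>\<^sub>v v + (-1) \<cdot>\<^sub>v (N *\<^sub>v v)"
    using idx by (intro eq_vecI) (simp_all add: algebra_simps)
  have MNv: "?MN = complex_of_real r \<cdot>\<^sub>v (M *\<^sub>v v) + (-1) \<cdot>\<^sub>v v"
    by (subst Nv) (simp add: linear_simps M_M)
  have NMv: "?NM = complex_of_real r \<cdot>\<^sub>v (N *\<^sub>v v) + (-1) \<cdot>\<^sub>v v"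
    by (subst Mv) (simp add: linear_simps N_N)
  have Kc [simp]: "K a \<in> carrier_vec m" if "a \<in> carrier_vec m" for a using that by (simp add: K_def)
  have KK: "K (K v) = complex_of_real (4 - r\<^sup>2) \<cdot>\<^sub>v v"
  proof -
    have "K (K v) = (v + (-1) \<cdot>\<^sub>v ?MN) + (-1) \<cdot>\<^sub>v (?NM + (-1) \<cdot>\<^sub>v v)"
      unfolding K_def by (simp add: linear_simps M_M N_N)
    also have "\<dots> = complex_of_real (4 - r\<^sup>2) \<cdot>\<^sub>v v"
      unfolding MNv NMv using idx
      by (intro eq_vecI) (simp_all add: power2_eq_square algebra_simps flip: distrib_left)
    finally show ?thesis .
  qed
  have Kadj: "K a \<bullet>c b = - (a \<bullet>c K b)" if "a \<in> carrier_vec m" "b \<in> carrier_vec m" for a b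
    using that unfolding K_def
    by (simp add: cscalar_add_left[of _ m] cscalar_add_right[of _ m] cscalar_smult_left[of _ m]
        cscalar_smult_right[of _ m] adjoint adjoint')
  have KvKv: "K v \<bullet>c K v = complex_of_real (r\<^sup>2 - 4) * (v \<bullet>c v)"
    by (simp add: Kadj KK cscalar_smult_right[of _ m] algebra_simps)
  \<comment> \<open>On v the square of \<open>K\<close> is 4 - r^2, and \<open>K\<close> is
    skew-adjoint; a negative r^2 - 4 would make \<open>K v\<close> have negative squared
    length.\<close>
  have r2: "r\<^sup>2 \<ge> 4"
  proof -
    have "K v \<bullet>c K v \<ge> 0" by auto
    moreover have "v \<bullet>c v \<ge> 0" by auto
    ultimately show ?thesis using vnz unfolding KvKv
      by (auto simp: less_eq_complex_def complex_eq_iff zero_le_mult_iff)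
  qed
  have r0: "r \<ge> 2" using r2 abs_le_square_iff[of 2 r] by (simp add: r_def)
  define s where "s = sqrt (r\<^sup>2 - 4)"
  have s2: "s\<^sup>2 = r\<^sup>2 - 4" using r2 by (auto simp: s_def)
  have Kj: "K (j a) = j (K a)" if "a \<in> carrier_vec m" for a
    using that unfolding K_def by (simp add: M_j N_j j_add j_smult) (intro eq_vecI, auto)
  have Ksm: "K (b \<cdot>\<^sub>v a) = b \<cdot>\<^sub>v K a" if "a \<in> carrier_vec m" for a b
    using that unfolding K_def by (simp add: linear_simps) (intro eq_vecI, auto simp: algebra_simps)
  have Kadd: "K (a + b) = K a + K b" if "a \<in> carrier_vec m" "b \<in> carrier_vec m" for a b
    using that unfolding K_def by (simp add: linear_simps) (intro eq_vecI, auto simp: algebra_simps)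
  define T where "T = j (K v)"
  have TW: "T \<in> W" using vW by (simp add: T_def Wj WK)
  have Tc [simp]: "T \<in> carrier_vec m" using TW Wc by blast
  then have [simp]: "dim_vec T = m" by (rule carrier_vecD)
  have jKT: "j (K T) = complex_of_real (s\<^sup>2) \<cdot>\<^sub>v v"
    unfolding T_def s2
    by (simp add: Kj j_j KK) (intro eq_vecI, auto simp: algebra_simps)
  \<comment> \<open>\<open>K\<close> sends the r-eigenspace of \<open>M + N\<close> to the
    eigenspace of -r, and \<open>j\<close> sends it back.\<close>
  have sumT: "M *\<^sub>v T + N *\<^sub>v T = complex_of_real r \<cdot>\<^sub>v T"
  proof -
    have "M *\<^sub>v T + N *\<^sub>v T = - j (N *\<^sub>v K v + M *\<^sub>v K v)"
      unfolding T_def by (simp add: M_j N_j j_add) (intro eq_vecI, auto)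
    also have "N *\<^sub>v K v + M *\<^sub>v K v = complex_of_real (- r) \<cdot>\<^sub>v K v"
    proof -
      have "N *\<^sub>v K v + M *\<^sub>v K v = (?NM + (-1) \<cdot>\<^sub>v v) + (v + (-1) \<cdot>\<^sub>v ?MN)"
        unfolding K_def by (simp add: linear_simps M_M N_N)
      also have "\<dots> = complex_of_real (- r) \<cdot>\<^sub>v K v"
        unfolding MNv NMv K_def by (intro eq_vecI) (simp_all add: algebra_simps)
      finally show ?thesis .
    qed
    also have "- j (complex_of_real (- r) \<cdot>\<^sub>v K v) = complex_of_real r \<cdot>\<^sub>v T"
      unfolding T_def by (simp add: j_smult) (intro eq_vecI, auto)
    finally show ?thesis .
  qed
  \<comment> \<open>If \<open>T + s v\<close> vanishes, then \<open>j (K v) = - s v\<close>, and multiplying \<open>v\<close> by the imaginary unit flips the sign.\<close>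
  obtain y where y: "y \<in> W" "y \<noteq> 0\<^sub>v m" "M *\<^sub>v y + N *\<^sub>v y = complex_of_real r \<cdot>\<^sub>v y"
    "j (K y) = complex_of_real s \<cdot>\<^sub>v y"
  proof (cases "T + complex_of_real s \<cdot>\<^sub>v v = 0\<^sub>v m")
    case True
    have Ti: "T $ i = - complex_of_real s * v $ i" if "i < m" for i
      using arg_cong[OF True, of "\<lambda>v. v $ i"] that by (simp add: eq_neg_iff_add_eq_0)
    show ?thesis
    proof (rule that[of "\<i> \<cdot>\<^sub>v v"])
      show "\<i> \<cdot>\<^sub>v v \<in> W" using vW Wsm by blast
      have "(\<i> \<cdot>\<^sub>v v) \<bullet>c (\<i> \<cdot>\<^sub>v v) = v \<bullet>c v"
        by (simp add: cscalar_smult_left[of _ m] cscalar_smult_right[of _ m])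
      then show "\<i> \<cdot>\<^sub>v v \<noteq> 0\<^sub>v m" using vnz by auto
      show "M *\<^sub>v (\<i> \<cdot>\<^sub>v v) + N *\<^sub>v (\<i> \<cdot>\<^sub>v v) = complex_of_real r \<cdot>\<^sub>v (\<i> \<cdot>\<^sub>v v)"
        using idx by (intro eq_vecI) (simp_all add: linear_simps algebra_simps flip: distrib_left)
      have "j (K (\<i> \<cdot>\<^sub>v v)) = (- \<i>) \<cdot>\<^sub>v T" by (simp add: Ksm j_smult T_def)
      then show "j (K (\<i> \<cdot>\<^sub>v v)) = complex_of_real s \<cdot>\<^sub>v (\<i> \<cdot>\<^sub>v v)"
        by (intro eq_vecI) (simp_all add: Ti)
    qed
  next
    case False
    \<comment> \<open>With R a = j (K a) and R^2 v = s^2 v, the vector R v + s v is mapped by R to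
      s^2 v + s R v, which is s times itself; antilinearity is harmless because s is real.\<close>
    show ?thesis
    proof (rule that[of "T + complex_of_real s \<cdot>\<^sub>v v"])
      show "T + complex_of_real s \<cdot>\<^sub>v v \<in> W" using vW TW Wsm Wadd by blast
      have idT: "(M *\<^sub>v T) $ i + (N *\<^sub>v T) $ i = complex_of_real r * T $ i" if "i < m" for i
        using arg_cong[OF sumT, of "\<lambda>v. v $ i"] that by simp
      have lin: "a + \<sigma> * c + (b + \<sigma> * d) = \<rho> * (t + \<sigma> * u)"
        if "a + b = \<rho> * t" "c + d = \<rho> * u" for a b c d t u \<rho> \<sigma> :: complex
      proof -
        have "a + \<sigma> * c + (b + \<sigma> * d) = (a + b) + \<sigma> * (c + d)" by (simp add: algebra_simps)
        then show ?thesis unfolding that by (simp add: algebra_simps)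
      qed
      have "(M *\<^sub>v T) $ i + complex_of_real s * (M *\<^sub>v v) $ i + ((N *\<^sub>v T) $ i + complex_of_real s * (N *\<^sub>v v) $ i)
          = complex_of_real r * (T $ i + complex_of_real s * v $ i)" if "i < m" for i
        by (rule lin[OF idT[OF that] idx[OF that]])
      then show "M *\<^sub>v (T + complex_of_real s \<cdot>\<^sub>v v) + N *\<^sub>v (T + complex_of_real s \<cdot>\<^sub>v v)
          = complex_of_real r \<cdot>\<^sub>v (T + complex_of_real s \<cdot>\<^sub>v v)"
        by (intro eq_vecI) (simp_all add: linear_simps)
      have "j (K (T + complex_of_real s \<cdot>\<^sub>v v)) = j (K T) + complex_of_real s \<cdot>\<^sub>v T"
        by (simp add: Kadd Ksm j_add j_smult T_def)
      then show "j (K (T + complex_of_real s \<cdot>\<^sub>v v)) = complex_of_real s \<cdot>\<^sub>v (T + complex_of_real s \<cdot>\<^sub>v v)"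
        unfolding jKT by (intro eq_vecI) (simp_all add: power2_eq_square algebra_simps)
    qed (use False in auto)
  qed
  have yc [simp]: "y \<in> carrier_vec m" using y Wc by blast
  then have [simp]: "dim_vec y = m" by (rule carrier_vecD)
  have "y \<bullet>c y > 0" using y(2) conjugate_square_greater_0_vec[OF yc] by simp
  then obtain t where t: "y \<bullet>c y = complex_of_real t" "t > 0"
    by (auto simp: less_complex_def intro!: complex_eqI that[of "Re (y \<bullet>c y)"])
  define a where "a = complex_of_real (1 / sqrt t)"
  define x where "x = a \<cdot>\<^sub>v y"
  have cnja [simp]: "cnj a = a" by (simp add: a_def)
  have xc [simp]: "x \<in> carrier_vec m" by (simp add: x_def)
  then have [simp]: "dim_vec x = m" by (rule carrier_vecD)
  have xx: "x \<bullet>c x = 1"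
  proof -
    have "x \<bullet>c x = complex_of_real (1 / sqrt t * (1 / sqrt t) * t :: real)"
      by (simp add: x_def cscalar_smult_left[of _ m] cscalar_smult_right[of _ m] t(1) a_def
          flip: of_real_mult)
    moreover have "(1 / sqrt t * (1 / sqrt t) * t :: real) = 1" using t(2) by simp
    ultimately show ?thesis by (simp only: of_real_1)
  qed
  have sumx: "M *\<^sub>v x + N *\<^sub>v x = complex_of_real r \<cdot>\<^sub>v x"
  proof -
    have "M *\<^sub>v x + N *\<^sub>v x = a \<cdot>\<^sub>v (M *\<^sub>v y + N *\<^sub>v y)"
      by (simp add: x_def linear_simps) (intro eq_vecI, auto simp: algebra_simps)
    also have "\<dots> = complex_of_real r \<cdot>\<^sub>v x" unfolding y(3) x_def by (simp add: smult_smult_assoc mult.commute)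
    finally show ?thesis .
  qed
  have jKx: "j (K x) = complex_of_real s \<cdot>\<^sub>v x"
    by (simp add: x_def Ksm j_smult y(4) smult_smult_assoc mult.commute)
  \<comment> \<open>One more application of \<open>j\<close> turns the eigenvector equation into (N
    - M) x = s j x, the second of the two equations to be solved for M x and N x.\<close>
  have "- K x = j (j (K x))" by (simp add: j_j)
  also have "\<dots> = complex_of_real s \<cdot>\<^sub>v j x" unfolding jKx by (simp add: j_smult)
  finally have negK: "- K x = complex_of_real s \<cdot>\<^sub>v j x" .
  have i1: "(M *\<^sub>v x) $ i + (N *\<^sub>v x) $ i = complex_of_real r * x $ i" if "i < m" for i
    using arg_cong[OF sumx, of "\<lambda>v. v $ i"] that by simp
  have i2: "(N *\<^sub>v x) $ i - (M *\<^sub>v x) $ i = complex_of_real s * j x $ i" if "i < m" for i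
    using arg_cong[OF negK, of "\<lambda>v. v $ i"] that by (simp add: K_def)
  have e: "(M *\<^sub>v x) $ i = complex_of_real (r / 2) * x $ i - complex_of_real (s / 2) * j x $ i"
    "(N *\<^sub>v x) $ i = complex_of_real (r / 2) * x $ i + complex_of_real (s / 2) * j x $ i" if "i < m" for i
  proof -
    have "a = P / 2 - Q / 2 \<and> b = P / 2 + Q / 2" if "a + b = P" "b - a = Q" for a b P Q :: complex
      unfolding that[symmetric] by (simp add: field_simps)
    from this[OF i1[OF that] i2[OF that]]
    show "(M *\<^sub>v x) $ i = complex_of_real (r / 2) * x $ i - complex_of_real (s / 2) * j x $ i"
      "(N *\<^sub>v x) $ i = complex_of_real (r / 2) * x $ i + complex_of_real (s / 2) * j x $ i"
      by simp_all
  qed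
  show ?thesis
  proof (rule that[of x "r / 2" "s / 2"])
    show "x \<in> W" using y Wsm by (simp add: x_def)
    show "(r / 2)\<^sup>2 - (s / 2)\<^sup>2 = 1" using s2 by (simp add: power_divide field_simps)
    show "M *\<^sub>v x = complex_of_real (r / 2) \<cdot>\<^sub>v x - complex_of_real (s / 2) \<cdot>\<^sub>v j x"
      using e(1) by (intro eq_vecI) (simp_all del: index_mult_mat_vec)
    show "N *\<^sub>v x = complex_of_real (r / 2) \<cdot>\<^sub>v x + complex_of_real (s / 2) \<cdot>\<^sub>v j x"
      using e(2) by (intro eq_vecI) (simp_all del: index_mult_mat_vec)
  qed (use xx r0 in auto)
qed

section \<open>Orthonormal frames built from invariant planes\<close>

definition adapted_frame :: "nat \<Rightarrow> (nat \<Rightarrow> complex vec) \<Rightarrow> (nat \<Rightarrow> real) \<Rightarrow> (nat \<Rightarrow> real) \<Rightarrow> bool" where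
  "adapted_frame k x c s \<longleftrightarrow> (\<forall>i<k. x i \<in> carrier_vec m \<and> c i \<ge> 1 \<and> (c i)\<^sup>2 - (s i)\<^sup>2 = 1 \<and>
     M *\<^sub>v x i = complex_of_real (c i) \<cdot>\<^sub>v x i - complex_of_real (s i) \<cdot>\<^sub>v j (x i) \<and>
     N *\<^sub>v x i = complex_of_real (c i) \<cdot>\<^sub>v x i + complex_of_real (s i) \<cdot>\<^sub>v j (x i) \<and>
     (\<forall>l<k. x i \<bullet>c x l = (if i = l then 1 else 0) \<and> x i \<bullet>c j (x l) = 0))"

lemma adapted_frameD:
  assumes "adapted_frame k x c s" "i < k"
  shows "x i \<in> carrier_vec m" "c i \<ge> 1" "(c i)\<^sup>2 - (s i)\<^sup>2 = 1"
    "M *\<^sub>v x i = complex_of_real (c i) \<cdot>\<^sub>v x i - complex_of_real (s i) \<cdot>\<^sub>v j (x i)"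
    "N *\<^sub>v x i = complex_of_real (c i) \<cdot>\<^sub>v x i + complex_of_real (s i) \<cdot>\<^sub>v j (x i)"
    "l < k \<Longrightarrow> x i \<bullet>c x l = (if i = l then 1 else 0)"
    "l < k \<Longrightarrow> x i \<bullet>c j (x l) = 0"
  using assms unfolding adapted_frame_def by blast+

text \<open>Each plane spanned by x i and j (x i) is stable under \<open>M\<close>, \<open>N\<close>
  and \<open>j\<close>. As \<open>M\<close> and \<open>N\<close> are mutually adjoint and
  \<open>j\<close> is antiunitary, the orthogonal complement of these planes is stable too, and it
  is nonzero while 2 k < 2 n. So the next vector can be chosen there.\<close>

lemma exists_adapted_frame:
  assumes m: "m = 2 * n" and "k \<le> n"
  shows "\<exists>x c s. adapted_frame k x c s"
  using assms(2)
proof (induction k)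
  case 0
  then show ?case by (simp add: adapted_frame_def)
next
  case (Suc k)
  then obtain x c s where frame: "adapted_frame k x c s" by auto
  note D = adapted_frameD[OF frame]
  note xc [simp] = D(1) and Mx = D(4) and Nx = D(5) and orth = D(6,7)
  have [simp]: "dim_vec (x i) = m" if "i < k" for i using carrier_vecD[OF xc[OF that]] .
  define W where "W = {w \<in> carrier_vec m. \<forall>i<k. w \<bullet>c x i = 0 \<and> w \<bullet>c j (x i) = 0}"
  have min: "a - b = a + (-1) \<cdot>\<^sub>v b" if "a \<in> carrier_vec m" "b \<in> carrier_vec m" for a b :: "complex vec"
    using that by (intro eq_vecI) auto
  have Mj: "M *\<^sub>v j (x i) = (- complex_of_real (c i)) \<cdot>\<^sub>v j (x i) + complex_of_real (s i) \<cdot>\<^sub>v x i" if "i < k" for i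
    using that by (simp add: M_j Nx j_add j_smult j_j) (intro eq_vecI, auto)
  have Nj: "N *\<^sub>v j (x i) = (- complex_of_real (c i)) \<cdot>\<^sub>v j (x i) + (- complex_of_real (s i)) \<cdot>\<^sub>v x i" if "i < k" for i
    using that by (simp add: N_j Mx min j_add j_smult j_j) (intro eq_vecI, auto)
  have inv: "invariant W"
    unfolding invariant_def
  proof (intro conjI ballI allI)
    show "W \<subseteq> carrier_vec m" by (auto simp: W_def)
    show "a + b \<in> W" if "a \<in> W" "b \<in> W" for a b
      using that by (simp add: W_def cscalar_add_left[of _ m])
    fix a assume "a \<in> W"
    then have a [simp]: "a \<in> carrier_vec m" and o: "\<And>i. i < k \<Longrightarrow> a \<bullet>c x i = 0 \<and> a \<bullet>c j (x i) = 0"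
      by (auto simp: W_def)
    show "c \<cdot>\<^sub>v a \<in> W" for c using o by (simp add: W_def cscalar_smult_left[of _ m])
    show "M *\<^sub>v a \<in> W" using o
      by (simp add: W_def adjoint Nx Nj cscalar_add_right[of _ m] cscalar_smult_right[of _ m])
    show "N *\<^sub>v a \<in> W" using o
      by (simp add: W_def adjoint' Mx Mj min cscalar_add_right[of _ m] cscalar_smult_right[of _ m])
    have "j a \<bullet>c x i = 0" "j a \<bullet>c j (x i) = 0" if "i < k" for i
      using o[OF that] cscalar_j_left[of a "x i"] j_cscalar[of a "x i"] that by simp_all
    then show "j a \<in> W" by (simp add: W_def)
  qed
  define u where "u i = (if i < k then x i else j (x (i - k)))" for i
  have "u i \<in> carrier_vec m" if "i < 2 * k" for i using that by (simp add: u_def)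
  then obtain w where w: "w \<in> carrier_vec m" "w \<noteq> 0\<^sub>v m" "\<And>i. i < 2 * k \<Longrightarrow> w \<bullet>c u i = 0"
    using exists_orthogonal_vector[of "2 * k" m u] Suc.prems m by auto
  have "w \<bullet>c x i = 0" "w \<bullet>c j (x i) = 0" if "i < k" for i
    using w(3)[of i] w(3)[of "k + i"] that by (simp_all add: u_def)
  then have "w \<in> W" using w(1) by (simp add: W_def)
  from exists_adapted_vector[OF inv this w(2)] obtain y d t where y: "y \<in> W" "y \<bullet>c y = 1" "d \<ge> 1" "d\<^sup>2 - t\<^sup>2 = 1"
    "M *\<^sub>v y = complex_of_real d \<cdot>\<^sub>v y - complex_of_real t \<cdot>\<^sub>v j y"
    "N *\<^sub>v y = complex_of_real d \<cdot>\<^sub>v y + complex_of_real t \<cdot>\<^sub>v j y" by metis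
  have yc [simp]: "y \<in> carrier_vec m" and oy: "\<And>i. i < k \<Longrightarrow> y \<bullet>c x i = 0" "\<And>i. i < k \<Longrightarrow> y \<bullet>c j (x i) = 0"
    using y(1) by (auto simp: W_def)
  have oy': "x i \<bullet>c y = 0" "x i \<bullet>c j y = 0" if "i < k" for i
    using oy[OF that] cscalar_commute[of "x i" m y] cscalar_commute[of "x i" m "j y"] that
      cscalar_j_left[of y "x i"] by simp_all
  show ?case
  proof (intro exI)
    show "adapted_frame (Suc k) (x(k := y)) (c(k := d)) (s(k := t))"
      unfolding adapted_frame_def using D y(2-) oy oy' by (auto simp: less_Suc_eq cscalar_j_self)
  qed
qed

end

section \<open>The matrices of the decomposition\<close>

lemma mat_adjoint_eq: "mat_adjoint A = map_mat cnj (transpose_mat A)" for A :: "complex mat"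
  unfolding mat_adjoint_def by (rule eq_matI) (auto simp: mat_of_rows_def)

lemma mat_adjoint_carrier [simp]:
  "A \<in> carrier_mat nr nc \<Longrightarrow> mat_adjoint A \<in> carrier_mat nc nr" for A :: "complex mat"
  by (simp add: mat_adjoint_eq)

lemma map_cnj_mult:
  fixes A B :: "complex mat"
  assumes "A \<in> carrier_mat nr k" "B \<in> carrier_mat k nc"
  shows "map_mat cnj (A * B) = map_mat cnj A * map_mat cnj B"
  using assms by (intro eq_matI) (auto simp: scalar_prod_def)

lemma mat_adjoint_mult:
  fixes A B :: "complex mat"
  assumes "A \<in> carrier_mat nr k" "B \<in> carrier_mat k nc"
  shows "mat_adjoint (A * B) = mat_adjoint B * mat_adjoint A"
  using assms map_cnj_mult[of "transpose_mat B" nc k "transpose_mat A" nr]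
  by (simp add: mat_adjoint_eq transpose_mult)

lemma mat_adjoint_adjoint [simp]: "mat_adjoint (mat_adjoint A) = A" for A :: "complex mat"
  by (rule eq_matI) (auto simp: mat_adjoint_eq)

lemma unitary_mat_inverse:
  assumes "unitary_mat m U"
  shows "mat_adjoint U * U = 1\<^sub>m m" "U * mat_adjoint U = 1\<^sub>m m"
  using assms mat_mult_left_right_inverse[of "mat_adjoint U" m U] by (auto simp: unitary_mat_def)

text \<open>The matrix L of the overview. Its eigenspaces are the two coordinate subspaces of
  dimension n, so commuting with it means being block diagonal.\<close>

definition grading_mat :: "nat \<Rightarrow> complex mat" where
  "grading_mat n = four_block_mat (1\<^sub>m n) (0\<^sub>m n n) (0\<^sub>m n n) (- 1\<^sub>m n)"

definition hyp_mat :: "nat \<Rightarrow> (nat \<Rightarrow> real) \<Rightarrow> complex mat" where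
  "hyp_mat n \<theta> = four_block_mat (Ch n \<theta>) (Sh n \<theta>) (Sh n \<theta>) (Ch n \<theta>)"

lemma Ch_carrier [simp]: "Ch n \<theta> \<in> carrier_mat n n" and Sh_carrier [simp]: "Sh n \<theta> \<in> carrier_mat n n"
  by (simp_all add: Ch_def Sh_def)

lemma block_carriers [simp]:
  "symp_J n \<in> carrier_mat (2 * n) (2 * n)" "grading_mat n \<in> carrier_mat (2 * n) (2 * n)"
  "hyp_mat n \<theta> \<in> carrier_mat (2 * n) (2 * n)"
  by (auto simp: symp_J_def grading_mat_def hyp_mat_def mult_2 intro!: four_block_carrier_mat)

lemma uminus_one_mult [simp]:
  fixes A :: "complex mat"
  assumes "A \<in> carrier_mat n n"
  shows "- 1\<^sub>m n * A = - A" "A * - 1\<^sub>m n = - A"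
  using assms by auto

lemma mat_diag_add: "mat_diag n f + mat_diag n g = mat_diag n (\<lambda>i. f i + g i :: complex)"
  by (intro eq_matI) (auto simp: mat_diag_def)

lemma mat_diag_uminus: "- mat_diag n f = mat_diag n (\<lambda>i. - f i :: complex)"
  by (intro eq_matI) (auto simp: mat_diag_def)

lemmas mult_four_block_square = mult_four_block_mat[of _ n n _ n _ n _ _ n _ n for n]

lemma square_mat_simps [simp]:
  fixes A :: "complex mat"
  assumes "A \<in> carrier_mat n n"
  shows "1\<^sub>m n * A = A" "A * 1\<^sub>m n = A" "0\<^sub>m n n * A = 0\<^sub>m n n" "A * 0\<^sub>m n n = 0\<^sub>m n n"
    "0\<^sub>m n n + A = A" "A + 0\<^sub>m n n = A"
  using assms by auto

lemma uminus_zero_mat [simp]: "- 0\<^sub>m nr nc = (0\<^sub>m nr nc :: complex mat)"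
  by (intro eq_matI) auto

text \<open>These matrices are exponentials of commuting symmetric matrices with off-diagonal blocks
  diag(\<theta>), so parameters add. In particular negating \<theta> inverts the matrix and doubling
  \<theta> squares it.\<close>

lemma hyp_mat_mult: "hyp_mat n \<theta> * hyp_mat n \<phi> = hyp_mat n (\<lambda>i. \<theta> i + \<phi> i)"
  unfolding hyp_mat_def
  by (subst mult_four_block_square[where n = n])
     (auto simp: Ch_def Sh_def mat_diag_add cosh_add sinh_add algebra_simps)

lemma hyp_mat_0: "hyp_mat n (\<lambda>i. 0) = 1\<^sub>m (2 * n)"
proof -
  have "mat_diag n (\<lambda>i. 0 :: complex) = 0\<^sub>m n n" by (intro eq_matI) (auto simp: mat_diag_def)
  then show ?thesis unfolding hyp_mat_def Ch_def Sh_def by (simp add: mult_2)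
qed

lemma hyp_mat_inverse: "hyp_mat n \<theta> * hyp_mat n (\<lambda>i. - \<theta> i) = 1\<^sub>m (2 * n)"
  "hyp_mat n (\<lambda>i. - \<theta> i) * hyp_mat n \<theta> = 1\<^sub>m (2 * n)"
  by (simp_all add: hyp_mat_mult hyp_mat_0)

text \<open>Conjugation by L changes the sign of the off-diagonal sinh blocks only, so L A = A^-1 L.
  This is the origin of the doubled angle: A L A^-1 = A^2 L.\<close>

lemma grading_hyp_mat: "grading_mat n * hyp_mat n \<theta> = hyp_mat n (\<lambda>i. - \<theta> i) * grading_mat n"
  unfolding hyp_mat_def grading_mat_def
  by (subst (1 2) mult_four_block_square[where n = n])
     (auto simp: Ch_def Sh_def mat_diag_uminus)

lemma transpose_hyp_mat: "transpose_mat (hyp_mat n \<theta>) = hyp_mat n \<theta>"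
  unfolding hyp_mat_def
  by (subst transpose_four_block_mat[of _ n n _ n _ n])
    (auto simp: Ch_def Sh_def mat_diag_def intro!: cong_four_block_mat eq_matI)

lemma mat_adjoint_hyp_mat: "mat_adjoint (hyp_mat n \<theta>) = hyp_mat n \<theta>"
  unfolding mat_adjoint_eq transpose_hyp_mat
  by (intro eq_matI) (auto simp: hyp_mat_def Ch_def Sh_def mat_diag_def)

lemma mat_adjoint_grading_mat: "mat_adjoint (grading_mat n) = grading_mat n"
  unfolding mat_adjoint_eq by (intro eq_matI) (auto simp: grading_mat_def)

text \<open>As A is symmetric, the identity J A = A^-1 J is just the symplectic condition for
  A.\<close>

lemma symp_J_hyp_mat: "symp_J n * hyp_mat n \<theta> = hyp_mat n (\<lambda>i. - \<theta> i) * symp_J n"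
  unfolding hyp_mat_def symp_J_def
  by (subst (1 2) mult_four_block_square[where n = n])
     (auto simp: Ch_def Sh_def mat_diag_uminus)

lemma grading_symp_J: "grading_mat n * symp_J n = - (symp_J n * grading_mat n)"
  unfolding grading_mat_def symp_J_def
  by (subst (1 2) mult_four_block_square[where n = n]) (auto intro!: eq_matI)

lemma grading_grading: "grading_mat n * grading_mat n = 1\<^sub>m (2 * n)"
  unfolding grading_mat_def
  by (subst mult_four_block_square[where n = n]) (auto simp: mult_2)

lemma symp_J_symp_J: "symp_J n * symp_J n = - 1\<^sub>m (2 * n)"
  unfolding symp_J_def
  by (subst mult_four_block_square[where n = n]) (auto intro!: eq_matI)

lemma transpose_grading: "transpose_mat (grading_mat n) = grading_mat n"
  by (intro eq_matI) (auto simp: grading_mat_def)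

lemma map_cnj_symp_J: "map_mat cnj (symp_J n) = symp_J n"
  unfolding symp_J_def by (intro eq_matI) auto

section \<open>Membership and closure properties of the symplectic group\<close>

lemma symplectic_hyp_mat: "symplectic_mat n (hyp_mat n \<theta>)"
proof -
  have "transpose_mat (hyp_mat n \<theta>) * symp_J n * hyp_mat n \<theta> =
     hyp_mat n \<theta> * (symp_J n * hyp_mat n \<theta>)"
    unfolding transpose_hyp_mat by (rule assoc_mult_mat[of _ "2 * n" "2 * n" _ "2 * n" _ "2 * n"]) auto
  also have "\<dots> = (hyp_mat n \<theta> * hyp_mat n (\<lambda>i. - \<theta> i)) * symp_J n"
    unfolding symp_J_hyp_mat by (rule assoc_mult_mat[of _ "2 * n" "2 * n" _ "2 * n" _ "2 * n", symmetric]) auto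
  finally show ?thesis by (simp add: symplectic_mat_def hyp_mat_inverse)
qed

lemma symplectic_mult:
  assumes "symplectic_mat n A" "symplectic_mat n B"
  shows "symplectic_mat n (A * B)"
proof -
  have [simp]: "A \<in> carrier_mat (2 * n) (2 * n)" "B \<in> carrier_mat (2 * n) (2 * n)"
    using assms by (auto simp: symplectic_mat_def)
  have "transpose_mat (A * B) * symp_J n * (A * B) = transpose_mat B * (transpose_mat A * symp_J n * A) * B"
    by (simp add: transpose_mult[of _ "2 * n" "2 * n" _ "2 * n"] assoc_mult_mat[of _ "2 * n" "2 * n" _ "2 * n" _ "2 * n"]
        mult_carrier_mat[of _ "2 * n" "2 * n" _ "2 * n"])
  then show ?thesis using assms by (simp add: symplectic_mat_def mult_carrier_mat[of _ "2 * n" "2 * n" _ "2 * n"])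
qed

lemma symplectic_inverse:
  assumes "symplectic_mat n A" "A * B = 1\<^sub>m (2 * n)" "B \<in> carrier_mat (2 * n) (2 * n)"
  shows "symplectic_mat n B"
proof -
  have [simp]: "A \<in> carrier_mat (2 * n) (2 * n)" using assms by (auto simp: symplectic_mat_def)
  have "transpose_mat B * symp_J n * B = transpose_mat B * (transpose_mat A * symp_J n * A) * B"
    using assms(1) by (simp add: symplectic_mat_def)
  also have "\<dots> = transpose_mat (A * B) * symp_J n * (A * B)"
    using assms(3) by (simp add: transpose_mult[of _ "2 * n" "2 * n" _ "2 * n"] assoc_mult_mat[of _ "2 * n" "2 * n" _ "2 * n" _ "2 * n"]
        mult_carrier_mat[of _ "2 * n" "2 * n" _ "2 * n"])
  finally show ?thesis using assms by (simp add: symplectic_mat_def)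
qed

text \<open>The inverse of a symplectic S in closed form, obtained from S^T J S = J and J^2 = -1; no
  matrix inversion has to be justified beforehand.\<close>

definition symp_inv :: "nat \<Rightarrow> complex mat \<Rightarrow> complex mat" where
  "symp_inv n S = - (symp_J n * transpose_mat S * symp_J n)"

definition grading_conj :: "nat \<Rightarrow> complex mat \<Rightarrow> complex mat" where
  "grading_conj n S = S * grading_mat n * symp_inv n S"

text \<open>L satisfies L^T J = - J L, and conjugation by a symplectic matrix preserves this
  property. Entrywise conjugation, which fixes the real matrix J, then replaces M^T by the adjoint
  of M.\<close>

lemma grading_conj_props:
  assumes "symplectic_mat n S"
  defines "M \<equiv> grading_conj n S"
  shows "M \<in> carrier_mat (2 * n) (2 * n)" "M * S = S * grading_mat n" "M * M = 1\<^sub>m (2 * n)"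
    "mat_adjoint M * symp_J n = - (symp_J n * map_mat cnj M)"
proof -
  let ?m = "2 * n" and ?J = "symp_J n" and ?L = "grading_mat n" and ?I = "symp_inv n S"
  have S [simp]: "S \<in> carrier_mat ?m ?m" and sym: "transpose_mat S * ?J * S = ?J"
    using assms by (auto simp: symplectic_mat_def)
  have [simp]: "transpose_mat S \<in> carrier_mat ?m ?m" by simp
  note [simp] = mult_carrier_mat[of _ ?m ?m _ ?m]
  note assoc = assoc_mult_mat[of _ ?m ?m _ ?m _ ?m]
  have I [simp]: "?I \<in> carrier_mat ?m ?m" by (simp add: symp_inv_def)
  have IS: "?I * S = 1\<^sub>m ?m"
  proof -
    have "?I * S = - (?J * transpose_mat S * ?J * S)"
      unfolding symp_inv_def by (rule uminus_mult_left_mat) (simp add: carrier_matD[OF S] carrier_matD[OF block_carriers(1)])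
    also have "?J * transpose_mat S * ?J * S = ?J * (transpose_mat S * ?J * S)" by (simp add: assoc)
    finally show ?thesis by (simp add: sym symp_J_symp_J) 
  qed
  then have SI: "S * ?I = 1\<^sub>m ?m" by (intro mat_mult_left_right_inverse[of ?I ?m S]) auto
  show M [simp]: "M \<in> carrier_mat ?m ?m" by (simp add: M_def grading_conj_def)
  show MS: "M * S = S * ?L"
    unfolding M_def grading_conj_def by (simp add: assoc IS)
  have "M * M = M * S * ?L * ?I" unfolding M_def grading_conj_def by (simp add: assoc)
  also have "\<dots> = S * (?L * ?L) * ?I" unfolding MS by (simp add: assoc)
  finally show "M * M = 1\<^sub>m ?m" by (simp add: grading_grading SI)
  \<comment> \<open>Both sides are compared after the congruence X -> S^T X S, where M S = S L
    reduces them to J L; the invertibility of S then removes the congruence.\<close>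
  have JM: "?J * M = - (transpose_mat M * ?J)"
  proof -
    have MT: "transpose_mat S * transpose_mat M = ?L * transpose_mat S"
      using arg_cong[OF MS, of transpose_mat] by (simp add: transpose_mult[of _ ?m ?m _ ?m] transpose_grading)
    have ST: "transpose_mat ?I * transpose_mat S = 1\<^sub>m ?m"
      using arg_cong[OF SI, of transpose_mat] by (simp add: transpose_mult[of _ ?m ?m _ ?m])
    have [simp]: "transpose_mat ?I \<in> carrier_mat ?m ?m" "transpose_mat M \<in> carrier_mat ?m ?m" by simp_all
    have "transpose_mat S * (?J * M) * S = transpose_mat S * ?J * (M * S)" by (simp add: assoc)
    also have "\<dots> = transpose_mat S * ?J * S * ?L" unfolding MS by (simp add: assoc)
    finally have 1: "transpose_mat S * (?J * M) * S = ?J * ?L" by (simp add: sym)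
    have "transpose_mat S * (transpose_mat M * ?J) * S = transpose_mat S * transpose_mat M * ?J * S" by (simp add: assoc)
    also have "\<dots> = ?L * (transpose_mat S * ?J * S)" unfolding MT by (simp add: assoc)
    finally have 2: "transpose_mat S * (transpose_mat M * ?J) * S = - (?J * ?L)"
      by (simp add: sym grading_symp_J)
    have cancel: "transpose_mat ?I * (transpose_mat S * X * S) * ?I = X" if [simp]: "X \<in> carrier_mat ?m ?m" for X
    proof -
      have "transpose_mat ?I * (transpose_mat S * X * S) * ?I = (transpose_mat ?I * transpose_mat S) * X * (S * ?I)"
        by (simp add: assoc)
      then show ?thesis by (simp add: ST SI)
    qed
    have "- (transpose_mat M * ?J) = - (transpose_mat ?I * (- (?J * ?L)) * ?I)"
      using cancel[of "transpose_mat M * ?J"] by (simp add: 2)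
    also have "\<dots> = transpose_mat ?I * (?J * ?L) * ?I"
      by (simp add: uminus_mult_left_mat uminus_mult_right_mat carrier_matD[OF I] carrier_matD[OF block_carriers(1)] carrier_matD[OF block_carriers(2)])
    also have "\<dots> = ?J * M" using cancel[of "?J * M"] by (simp add: 1)
    finally show ?thesis by simp
  qed
  have "map_mat cnj (?J * M) = map_mat cnj (- (transpose_mat M * ?J))" unfolding JM ..
  also have "\<dots> = - map_mat cnj (transpose_mat M * ?J)" by (intro eq_matI) auto
  finally have "?J * map_mat cnj M = - (mat_adjoint M * ?J)"
    by (simp add: map_cnj_mult[of _ ?m ?m _ ?m] map_cnj_symp_J mat_adjoint_eq)
  then show "mat_adjoint M * ?J = - (?J * map_mat cnj M)" by simp
qed

section \<open>Uniqueness\<close>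

definition spectral_fun :: "nat \<Rightarrow> (nat \<Rightarrow> real) \<Rightarrow> nat \<Rightarrow> complex" where
  "spectral_fun n \<theta> i = (if i < n then complex_of_real (2 * cosh (2 * \<theta> i))
     else - complex_of_real (2 * cosh (2 * \<theta> (i - n))))"

text \<open>L commutes with the cosh blocks and anticommutes with the sinh blocks, so the latter
  cancel in the symmetrised product.\<close>

lemma hyp_mat_grading_sum:
  "hyp_mat n (\<lambda>i. 2 * \<theta> i) * grading_mat n + grading_mat n * hyp_mat n (\<lambda>i. 2 * \<theta> i)
     = mat_diag (2 * n) (spectral_fun n \<theta>)"
  unfolding hyp_mat_def grading_mat_def
  by (subst (1 2) mult_four_block_square[where n = n])
    (auto simp: Ch_def Sh_def mat_diag_def spectral_fun_def intro!: eq_matI)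

lemma hyp_decomp_grading_conj:
  assumes S: "symplectic_mat n S" and dec: "hyp_decomp n S U G \<theta>"
  defines "M \<equiv> grading_conj n S"
  shows "M + mat_adjoint M = U * mat_diag (2 * n) (spectral_fun n \<theta>) * mat_adjoint U"
proof -
  let ?m = "2 * n" and ?A = "hyp_mat n \<theta>" and ?L = "grading_mat n" and ?A2 = "hyp_mat n (\<lambda>i. 2 * \<theta> i)"
  let ?D = "four_block_mat G (0\<^sub>m n n) (0\<^sub>m n n) (transpose_mat (mat_inv G))"
  let ?E = "four_block_mat (mat_inv G) (0\<^sub>m n n) (0\<^sub>m n n) (transpose_mat G)"
  have U: "unitary_mat ?m U" and G [simp]: "G \<in> carrier_mat n n" and iG: "invertible_mat G"
    and SUAD: "S = U * ?A * ?D"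
    using dec by (auto simp: hyp_decomp_def hyp_mat_def)
  have [simp]: "U \<in> carrier_mat ?m ?m" using U by (simp add: unitary_mat_def)
  note UU = unitary_mat_inverse[OF U]
  note Gi = mat_inv_correct[OF G iG]
  note [simp] = mult_carrier_mat[of _ ?m ?m _ ?m] Gi(1)
  note assoc = assoc_mult_mat[of _ ?m ?m _ ?m _ ?m]
  have [simp]: "?D \<in> carrier_mat ?m ?m" "?E \<in> carrier_mat ?m ?m"
    by (auto simp: mult_2 intro!: four_block_carrier_mat)
  have [simp]: "transpose_mat G \<in> carrier_mat n n" "transpose_mat (mat_inv G) \<in> carrier_mat n n" by simp_all
  have DE: "?D * ?E = 1\<^sub>m ?m"
    by (subst mult_four_block_square[where n = n])
      (simp_all add: Gi transpose_mult[of _ n n _ n, symmetric] mult_2)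
  have DL: "?D * ?L = ?L * ?D"
    unfolding grading_mat_def
    by (subst (1 2) mult_four_block_square[where n = n]) simp_all
  note props = grading_conj_props[OF S, folded M_def]
  have [simp]: "M \<in> carrier_mat ?m ?m" by (rule props(1))
  have AL: "?A * ?L * hyp_mat n (\<lambda>i. - \<theta> i) = ?A2 * ?L"
  proof -
    have "?L * hyp_mat n (\<lambda>i. - \<theta> i) = ?A * ?L" using grading_hyp_mat[of n "\<lambda>i. - \<theta> i"] by simp
    then have "?A * ?L * hyp_mat n (\<lambda>i. - \<theta> i) = ?A * (?A * ?L)" by (simp add: assoc)
    moreover have "?A * (?A * ?L) = ?A * ?A * ?L" by (simp add: assoc)
    moreover have "?A * ?A = ?A2" by (simp add: hyp_mat_mult)
    ultimately show ?thesis by simp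
  qed
  have "M * (U * ?A * ?D) = U * ?A * ?D * ?L" using props(2) SUAD by simp
  also have "\<dots> = U * ?A * ?L * ?D" using DL by (simp add: assoc)
  finally have "M * (U * ?A * ?D) * ?E * hyp_mat n (\<lambda>i. - \<theta> i) * mat_adjoint U
      = U * ?A * ?L * ?D * ?E * hyp_mat n (\<lambda>i. - \<theta> i) * mat_adjoint U" by simp
  moreover have "M * (U * ?A * ?D) * ?E * hyp_mat n (\<lambda>i. - \<theta> i) * mat_adjoint U
      = M * (U * (?A * ((?D * ?E) * hyp_mat n (\<lambda>i. - \<theta> i))) * mat_adjoint U)" by (simp add: assoc)
  moreover have "\<dots> = M" by (simp add: DE hyp_mat_inverse UU)
  moreover have "U * ?A * ?L * ?D * ?E * hyp_mat n (\<lambda>i. - \<theta> i) * mat_adjoint U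
      = U * (?A * ?L * ((?D * ?E) * hyp_mat n (\<lambda>i. - \<theta> i))) * mat_adjoint U" by (simp add: assoc)
  ultimately have M: "M = U * (?A2 * ?L) * mat_adjoint U" by (simp add: DE AL)
  have "mat_adjoint M = U * (?L * ?A2) * mat_adjoint U"
    unfolding M by (simp add: mat_adjoint_mult[of _ ?m ?m _ ?m] mat_adjoint_hyp_mat mat_adjoint_grading_mat assoc)
  then have "M + mat_adjoint M = U * (?A2 * ?L) * mat_adjoint U + U * (?L * ?A2) * mat_adjoint U"
    using M by simp
  also have "\<dots> = U * (?A2 * ?L + ?L * ?A2) * mat_adjoint U"
    by (simp add: add_mult_distrib_mat[of _ ?m ?m _ _ ?m] mult_add_distrib_mat[of _ ?m ?m _ ?m])
  finally show ?thesis unfolding hyp_mat_grading_sum .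
qed

lemma proots_char_poly_mat_diag:
  "proots (char_poly (mat_diag m f)) = image_mset f (mset_set {..<m})" for f :: "nat \<Rightarrow> complex"
proof -
  have "char_poly (mat_diag m f) = (\<Prod>a\<leftarrow>diag_mat (mat_diag m f). [:- a, 1:])"
    by (rule char_poly_upper_triangular[OF mat_diag_dim]) (auto simp: mat_diag_def)
  also have "diag_mat (mat_diag m f) = map f [0..<m]" by (auto simp: diag_mat_def mat_diag_def)
  also have "(\<Prod>a\<leftarrow>map f [0..<m]. [:- a, 1:]) = (\<Prod>i<m. [:- f i, 1:])"
    by (induction m) (simp_all add: lessThan_Suc mult.commute)
  finally have "proots (char_poly (mat_diag m f)) = (\<Sum>i<m. {#f i#})"
    by (simp add: proots_prod)
  also have "\<dots> = image_mset f (mset_set {..<m})"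
    by (induction m) (simp_all add: lessThan_Suc)
  finally show ?thesis .
qed

text \<open>\<open>H\<close> is built from S alone, so any two decompositions give the same multiset
  of roots of its characteristic polynomial. Multisets keep track of multiplicities, which is what a
  permutation of the parameters requires.\<close>

lemma hyp_decomp_unique:
  assumes S: "symplectic_mat n S" and dec: "hyp_decomp n S U G \<theta>" and dec': "hyp_decomp n S U' G' \<theta>'"
  shows "eq_up_to_order_and_signs n \<theta> \<theta>'"
proof -
  define H where "H = grading_conj n S + mat_adjoint (grading_conj n S)"
  have roots: "proots (char_poly H) = image_mset (spectral_fun n \<phi>) (mset_set {..<2 * n})"
    if d: "hyp_decomp n S V K \<phi>" for V K \<phi>
  proof -
    have V: "unitary_mat (2 * n) V" using d by (simp add: hyp_decomp_def)
    have "similar_mat H (mat_diag (2 * n) (spectral_fun n \<phi>))"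
    proof (rule similar_matI)
      show "H = V * mat_diag (2 * n) (spectral_fun n \<phi>) * mat_adjoint V"
        unfolding H_def by (rule hyp_decomp_grading_conj[OF S d])
      show "{H, mat_diag (2 * n) (spectral_fun n \<phi>), V, mat_adjoint V} \<subseteq> carrier_mat (2 * n) (2 * n)"
        using V grading_conj_props(1)[OF S] by (simp add: unitary_mat_def H_def)
    qed (use unitary_mat_inverse[OF V] in auto)
    then show ?thesis using char_poly_similar proots_char_poly_mat_diag by metis
  qed
  \<comment> \<open>The positive roots are the values 2 cosh (2 \<phi> i), and arcosh recovers 2
    \<phi> i up to its sign.\<close>
  have pos: "image_mset (\<lambda>i. \<bar>\<phi> i\<bar>) (mset_set {..<n})
      = image_mset (\<lambda>z. arcosh (Re z / 2) / 2) (filter_mset (\<lambda>z. Re z > 0) (proots (char_poly H)))"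
    if d: "hyp_decomp n S V K \<phi>" for V K \<phi>
  proof -
    have "{i. i < 2 * n \<and> Re (spectral_fun n \<phi> i) > 0} = {..<n}"
      by (auto simp: spectral_fun_def split: if_splits) (smt (verit) cosh_real_pos)
    then have "filter_mset (\<lambda>z. Re z > 0) (proots (char_poly H)) = image_mset (spectral_fun n \<phi>) (mset_set {..<n})"
      unfolding roots[OF d] by (simp add: filter_mset_image_mset)
    moreover have "arcosh (Re (spectral_fun n \<phi> i) / 2) / 2 = \<bar>\<phi> i\<bar>" if "i < n" for i
    proof -
      have "arcosh (cosh (2 * \<phi> i)) = \<bar>2 * \<phi> i\<bar>"
        by (metis abs_ge_zero arcosh_cosh_real cosh_real_abs)
      then show ?thesis using that by (simp add: spectral_fun_def)
    qed
    ultimately show ?thesis by (auto simp: multiset.map_comp intro!: image_mset_cong)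
  qed
  have "image_mset (\<lambda>i. \<bar>\<theta>' i\<bar>) (mset_set {..<n}) = image_mset (\<lambda>i. \<bar>\<theta> i\<bar>) (mset_set {..<n})"
    unfolding pos[OF dec] pos[OF dec'] ..
  then obtain p where p: "p permutes {..<n}" "\<forall>i\<in>{..<n}. \<bar>\<theta>' i\<bar> = \<bar>\<theta> (p i)\<bar>"
    using image_mset_eq_implies_permutes[of "{..<n}" "\<lambda>i. \<bar>\<theta>' i\<bar>" "\<lambda>i. \<bar>\<theta> i\<bar>"] by auto
  define s :: "nat \<Rightarrow> real" where "s i = (if \<theta>' i = \<theta> (p i) then 1 else - 1)" for i
  have "\<forall>i<n. s i \<in> {- 1, 1} \<and> \<theta>' i = s i * \<theta> (p i)"
    using p(2) by (auto simp: s_def abs_eq_iff)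
  with p(1) show ?thesis unfolding eq_up_to_order_and_signs_def by blast
qed

section \<open>Existence\<close>

lemma conjugate_mult_mat_vec:
  fixes A :: "complex mat"
  assumes "A \<in> carrier_mat nr nc" "v \<in> carrier_vec nc"
  shows "conjugate (A *\<^sub>v v) = map_mat cnj A *\<^sub>v conjugate v"
  using assms by (intro eq_vecI) (auto simp: scalar_prod_def)

lemma cscalar_mat_adjoint:
  fixes A :: "complex mat"
  assumes "A \<in> carrier_mat nr nc" "a \<in> carrier_vec nc" "b \<in> carrier_vec nr"
  shows "(A *\<^sub>v a) \<bullet>c b = a \<bullet>c (mat_adjoint A *\<^sub>v b)"
proof -
  have "(A *\<^sub>v a) \<bullet>c b = (\<Sum>i<nr. \<Sum>k<nc. A $$ (i,k) * a $ k * cnj (b $ i))"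
    using assms by (auto simp: scalar_prod_def atLeast0LessThan sum_distrib_right intro!: sum.cong)
  also have "\<dots> = (\<Sum>k<nc. \<Sum>i<nr. A $$ (i,k) * a $ k * cnj (b $ i))" by (rule sum.swap)
  also have "\<dots> = a \<bullet>c (mat_adjoint A *\<^sub>v b)"
    using assms by (auto simp: mat_adjoint_eq scalar_prod_def atLeast0LessThan sum_distrib_left mult_ac intro!: sum.cong)
  finally show ?thesis .
qed

text \<open>The columns of V are a full adapted frame x i followed by - j (x i). Orthonormality
  makes V unitary, compatibility with \<open>j\<close> makes it symplectic, and the formulas for
  \<open>M\<close> on each plane give the last equation.\<close>

lemma exists_unitary_symplectic_reduction:
  assumes M: "M \<in> carrier_mat (2 * n) (2 * n)" and MM: "M * M = 1\<^sub>m (2 * n)"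
    and MJ: "mat_adjoint M * symp_J n = - (symp_J n * map_mat cnj M)"
  obtains V \<theta> where "unitary_mat (2 * n) V" "symplectic_mat n V"
    "M * V = V * (hyp_mat n (\<lambda>i. 2 * \<theta> i) * grading_mat n)"
proof -
  let ?m = "2 * n" and ?J = "symp_J n"
  define j where "j a = ?J *\<^sub>v conjugate a" for a
  have J [simp]: "?J \<in> carrier_mat ?m ?m" by simp
  have jc [simp]: "j a \<in> carrier_vec ?m" if "a \<in> carrier_vec ?m" for a
    using that mult_mat_vec_carrier[OF J] by (simp add: j_def)
  have JJ: "?J *\<^sub>v (?J *\<^sub>v a) = - a" if "a \<in> carrier_vec ?m" for a
  proof -
    have "?J *\<^sub>v (?J *\<^sub>v a) = (- 1\<^sub>m ?m) *\<^sub>v a"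
      using assoc_mult_mat_vec[OF J J that] by (simp add: symp_J_symp_J)
    then show ?thesis using that by simp
  qed
  have Jadj: "mat_adjoint ?J = - ?J"
    unfolding mat_adjoint_eq symp_J_def by (intro eq_matI) auto
  have cJ: "conjugate (?J *\<^sub>v a) = ?J *\<^sub>v conjugate a" if "a \<in> carrier_vec ?m" for a
    using conjugate_mult_mat_vec[OF J that] by (simp add: map_cnj_symp_J)
  interpret quaternionic_involution ?m M "mat_adjoint M" j
  proof
    fix a b :: "complex vec" and c :: complex assume a: "a \<in> carrier_vec ?m"
    show "j (c \<cdot>\<^sub>v a) = cnj c \<cdot>\<^sub>v j a"
      using a mult_mat_vec[OF J, of "conjugate a" "cnj c"] by (simp add: j_def conjugate_smult_vec)
    show "j (j a) = - a" using a by (simp add: j_def cJ JJ)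
    show "M *\<^sub>v (M *\<^sub>v a) = a" using assoc_mult_mat_vec[OF M M a] a by (simp add: MM)
    have Ma: "M *\<^sub>v a \<in> carrier_vec ?m" using mult_mat_vec_carrier[OF M a] .
    have cM: "map_mat cnj M \<in> carrier_mat ?m ?m" using M by simp
    have "mat_adjoint M *\<^sub>v j a = (mat_adjoint M * ?J) *\<^sub>v conjugate a"
      unfolding j_def using assoc_mult_mat_vec[OF mat_adjoint_carrier[OF M] J, of "conjugate a"] a by simp
    also have "\<dots> = - ((?J * map_mat cnj M) *\<^sub>v conjugate a)"
      unfolding MJ using a mult_carrier_mat[OF J cM] carrier_matD[OF cM] carrier_matD[OF J]
      by (intro eq_vecI) auto
    also have "(?J * map_mat cnj M) *\<^sub>v conjugate a = ?J *\<^sub>v conjugate (M *\<^sub>v a)"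
      using assoc_mult_mat_vec[OF J cM, of "conjugate a"] a conjugate_mult_mat_vec[OF M a] by simp
    finally show "mat_adjoint M *\<^sub>v j a = - j (M *\<^sub>v a)" unfolding j_def .
    assume b: "b \<in> carrier_vec ?m"
    show "(M *\<^sub>v a) \<bullet>c b = a \<bullet>c (mat_adjoint M *\<^sub>v b)" by (rule cscalar_mat_adjoint[OF M a b])
    show "j (a + b) = j a + j b"
      using a b mult_add_distrib_mat_vec[OF J, of "conjugate a" "conjugate b"] by (simp add: j_def conjugate_add_vec[of _ ?m])
    have "j a \<bullet>c j b = conjugate a \<bullet>c (mat_adjoint ?J *\<^sub>v j b)"
      unfolding j_def using cscalar_mat_adjoint[OF J, of "conjugate a" "?J *\<^sub>v conjugate b"] a b jc[OF b]
      by (simp add: j_def)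
    also have "mat_adjoint ?J *\<^sub>v j b = - (?J *\<^sub>v (?J *\<^sub>v conjugate b))"
      unfolding Jadj j_def using b carrier_matD[OF J] by (intro eq_vecI) auto
    also have "\<dots> = conjugate b" using b by (simp add: JJ)
    also have "conjugate a \<bullet>c conjugate b = cnj (a \<bullet>c b)"
      using a b conjugate_sprod_vec[of a ?m "conjugate b"] by simp
    finally show "j a \<bullet>c j b = cnj (a \<bullet>c b)" .
  qed (use M jc in auto)
  obtain x c s where frame: "adapted_frame n x c s" using exists_adapted_frame[of n n] by auto
  note D = adapted_frameD[OF frame]
  have xc [simp]: "x i \<in> carrier_vec ?m" if "i < n" for i using D(1)[OF that] .
  have [simp]: "dim_vec (x i) = ?m" if "i < n" for i using carrier_vecD[OF xc[OF that]] .
  \<comment> \<open>Prescribing sinh (2 \<theta>) = s fixes cosh (2 \<theta>) up to sign by c^2 -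
    s^2 = 1, and c >= 1 selects the right sign.\<close>
  define \<theta> where "\<theta> i = arsinh (s i) / 2" for i
  have sh: "sinh (2 * \<theta> i) = s i" for i by (simp add: \<theta>_def)
  have ch: "cosh (2 * \<theta> i) = c i" if "i < n" for i
  proof -
    have "(cosh (2 * \<theta> i))\<^sup>2 = (c i)\<^sup>2" using D(3)[OF that] sh[of i] by (simp add: cosh_square_eq)
    then show ?thesis using D(2)[OF that] cosh_real_ge_1[of "2 * \<theta> i"] power2_eq_imp_eq by force
  qed
  \<comment> \<open>The minus sign yields V J = J conj(V), and it turns M x = c x - s j x into the
    column (c, s) of A^2 L.\<close>
  define v where "v l = (if l < n then x l else - j (x (l - n)))" for l
  have vc [simp]: "v l \<in> carrier_vec ?m" if "l < ?m" for l using that by (simp add: v_def)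
  then have dv [simp]: "dim_vec (v l) = ?m" if "l < ?m" for l using that by (auto intro: carrier_vecD)
  define V where "V = mat ?m ?m (\<lambda>(i,l). v l $ i)"
  have V [simp]: "V \<in> carrier_mat ?m ?m" by (simp add: V_def)
  have colV: "col V l = v l" if "l < ?m" for l
    using that by (intro eq_vecI) (simp_all add: V_def)
  have ip: "v k \<bullet>c v l = (if k = l then 1 else 0)" if "k < ?m" "l < ?m" for k l
  proof -
    have neg: "(- a) \<bullet>c b = - (a \<bullet>c b)" "b \<bullet>c (- a) = - (b \<bullet>c a)"
      if "a \<in> carrier_vec ?m" "b \<in> carrier_vec ?m" for a b :: "complex vec"
      using that cscalar_smult_left[of a ?m b "-1"] cscalar_smult_right[of a ?m b "-1"] by (simp_all add: uminus_conv)
    consider "k < n" "l < n" | "k < n" "l \<ge> n" | "k \<ge> n" "l < n" | "k \<ge> n" "l \<ge> n" by linarith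
    then show ?thesis
    proof cases
      case 1
      then show ?thesis using D(6)[of k l] by (simp add: v_def)
    next
      case 2
      then show ?thesis using D(7)[of k "l - n"] that by (simp add: v_def neg)
    next
      case 3
      then show ?thesis using D(7)[of l "k - n"] that cscalar_commute[of "j (x (k - n))" ?m "x l"]
        by (simp add: v_def neg)
    next
      case 4
      then show ?thesis using D(6)[of "k - n" "l - n"] that by (simp add: v_def neg j_cscalar) auto
    qed
  qed
  have unit: "mat_adjoint V * V = 1\<^sub>m ?m"
  proof (rule eq_matI)
    fix i l assume "i < dim_row (1\<^sub>m ?m)" "l < dim_col (1\<^sub>m ?m)"
    then have il: "i < ?m" "l < ?m" by auto
    have "row (mat_adjoint V) i = conjugate (v i)"
      using il by (intro eq_vecI) (auto simp: mat_adjoint_eq V_def)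
    then have "(mat_adjoint V * V) $$ (i,l) = conjugate (v i) \<bullet> v l"
      using il colV[OF il(2)] by (simp add: mat_adjoint_eq V_def)
    also have "\<dots> = v l \<bullet>c v i" using conjugate_vec_sprod_comm[of "v l" ?m "v i"] il by simp
    finally show "(mat_adjoint V * V) $$ (i,l) = 1\<^sub>m ?m $$ (i,l)" using ip il by auto
  qed (auto simp: mat_adjoint_eq V_def)
  define X where "X = mat ?m n (\<lambda>(i,l). x l $ i)"
  define Y where "Y = mat ?m n (\<lambda>(i,l). - j (x l) $ i)"
  have [simp]: "X \<in> carrier_mat ?m n" "Y \<in> carrier_mat ?m n" by (simp_all add: X_def Y_def)
  \<comment> \<open>Bottom blocks of height 0 let the one-row block matrix [X Y] take part in
    four-block multiplication.\<close>
  have VXY: "V = four_block_mat X Y (0\<^sub>m 0 n) (0\<^sub>m 0 n)"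
    unfolding V_def by (rule eq_matI) (auto simp: X_def Y_def v_def)
  have Vblock: "V * four_block_mat P Q R T = four_block_mat (X * P + Y * R) (X * Q + Y * T) (0\<^sub>m 0 n) (0\<^sub>m 0 n)"
    if "P \<in> carrier_mat n n" "Q \<in> carrier_mat n n" "R \<in> carrier_mat n n" "T \<in> carrier_mat n n" for P Q R T
    unfolding VXY by (subst mult_four_block_mat[of _ ?m n _ n _ 0 _ _ n _ n]) (use that in auto)
  have jv: "j (v l) = (if l < n then - v (l + n) else v (l - n))" if "l < ?m" for l
    using that by (auto simp: v_def j_uminus j_j)
  have JV: "V * ?J = ?J * map_mat cnj V"
  proof (rule eq_matI)
    fix i l assume "i < dim_row (?J * map_mat cnj V)" "l < dim_col (?J * map_mat cnj V)"
    then have il: "i < ?m" "l < ?m" using carrier_matD[OF J] by (auto simp: V_def)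
    have "col (map_mat cnj V) l = conjugate (v l)"
      using il by (intro eq_vecI) (auto simp: V_def)
    then have "(?J * map_mat cnj V) $$ (i,l) = j (v l) $ i"
      using il carrier_matD[OF J] by (simp add: j_def V_def)
    moreover have "(V * ?J) $$ (i,l) = j (v l) $ i"
      unfolding symp_J_def jv[OF il(2)]
      by (subst Vblock) (use il in \<open>auto simp: X_def Y_def v_def\<close>)
    ultimately show "(V * ?J) $$ (i,l) = (?J * map_mat cnj V) $$ (i,l)" by simp
  qed (use carrier_matD[OF J] in \<open>auto simp: V_def\<close>)
  \<comment> \<open>Conjugating V J = J conj(V) replaces J V by conj(V) J in V^T J V, and V^T
    conj(V) is the conjugate of the identity proved in \<open>unit\<close>.\<close>
  have symp: "symplectic_mat n V"
  proof -
    have [simp]: "map_mat cnj V \<in> carrier_mat ?m ?m" "transpose_mat V \<in> carrier_mat ?m ?m" by simp_all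
    have c: "map_mat cnj (map_mat cnj V) = V" by (intro eq_matI) auto
    have "map_mat cnj (V * ?J) = map_mat cnj (?J * map_mat cnj V)" unfolding JV ..
    then have "map_mat cnj V * ?J = ?J * V"
      by (simp add: map_cnj_mult[of _ ?m ?m _ ?m] map_cnj_symp_J c)
    then have "transpose_mat V * ?J * V = transpose_mat V * (map_mat cnj V * ?J)"
      by (simp add: assoc_mult_mat[of _ ?m ?m _ ?m _ ?m])
    also have "\<dots> = (transpose_mat V * map_mat cnj V) * ?J"
      by (simp add: assoc_mult_mat[of _ ?m ?m _ ?m _ ?m])
    also have "transpose_mat V * map_mat cnj V = map_mat cnj (mat_adjoint V * V)"
    proof -
      have "map_mat cnj (mat_adjoint V) = transpose_mat V" unfolding mat_adjoint_eq by (intro eq_matI) auto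
      then show ?thesis by (simp add: map_cnj_mult[of _ ?m ?m _ ?m])
    qed
    also have "\<dots> = 1\<^sub>m ?m" unfolding unit by (intro eq_matI) auto
    finally show ?thesis by (simp add: symplectic_mat_def)
  qed
  have "M * V = V * (hyp_mat n (\<lambda>i. 2 * \<theta> i) * grading_mat n)"
  proof -
    let ?C = "Ch n (\<lambda>i. 2 * \<theta> i)" and ?S = "Sh n (\<lambda>i. 2 * \<theta> i)"
    have "hyp_mat n (\<lambda>i. 2 * \<theta> i) * grading_mat n = four_block_mat ?C (- ?S) ?S (- ?C)"
      unfolding hyp_mat_def grading_mat_def by (subst mult_four_block_square[where n = n]) simp_all
    then have "V * (hyp_mat n (\<lambda>i. 2 * \<theta> i) * grading_mat n)
        = four_block_mat (X * ?C + Y * ?S) (X * - ?S + Y * - ?C) (0\<^sub>m 0 n) (0\<^sub>m 0 n)"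
      by (simp add: Vblock)
    also have "\<dots> = M * V"
    proof (rule eq_matI)
      fix i l assume "i < dim_row (M * V)" "l < dim_col (M * V)"
      then have il: "i < ?m" "l < ?m" using M by (auto simp: V_def)
      have MVil: "(M * V) $$ (i,l) = (M *\<^sub>v v l) $ i" using il M colV[OF il(2)] by (simp add: V_def)
      have Mj': "M *\<^sub>v (- j (x k)) = complex_of_real (c k) \<cdot>\<^sub>v j (x k) - complex_of_real (s k) \<cdot>\<^sub>v x k" if "k < n" for k
        using that D(5)[OF that] by (simp add: uminus_conv linear_simps M_j j_add j_smult j_j smult_smult_assoc)
          (intro eq_vecI, auto)
      show "four_block_mat (X * ?C + Y * ?S) (X * - ?S + Y * - ?C) (0\<^sub>m 0 n) (0\<^sub>m 0 n) $$ (i,l) = (M * V) $$ (i,l)"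
      proof (cases "l < n")
        case True
        then show ?thesis using il unfolding MVil
          by (simp add: v_def D(4) Ch_def Sh_def mat_diag_mult_right[of _ ?m n] ch sh X_def Y_def del: index_mult_mat_vec)
      next
        case False
        then have "l - n < n" using il by auto
        then show ?thesis using il False unfolding MVil
          by (simp add: v_def Mj' Ch_def Sh_def mat_diag_uminus mat_diag_mult_right[of _ ?m n] ch sh X_def Y_def
              del: index_mult_mat_vec)
      qed
    qed (use M carrier_matD[OF Sh_carrier[of n]] carrier_matD[OF Ch_carrier[of n]] in \<open>auto simp: V_def X_def Y_def\<close>)
    finally show ?thesis ..
  qed
  moreover have "unitary_mat ?m V" using unit by (simp add: unitary_mat_def)
  ultimately show ?thesis using that symp by blast
qed

section \<open>The block-diagonal right factor and the assembly of the decomposition\<close>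

lemma commutes_grading_imp_block_diag:
  assumes D: "D \<in> carrier_mat (2 * n) (2 * n)" and comm: "D * grading_mat n = grading_mat n * D"
  obtains G F where "G \<in> carrier_mat n n" "F \<in> carrier_mat n n"
    "D = four_block_mat G (0\<^sub>m n n) (0\<^sub>m n n) F"
proof -
  obtain G P Q F where s: "split_block D n n = (G, P, Q, F)" by (metis prod_cases4)
  have D': "D \<in> carrier_mat (n + n) (n + n)" using D by (simp add: mult_2)
  note sb = split_block[OF s carrier_matD[OF D']]
  note [simp] = sb(1-4)
  \<comment> \<open>Right multiplication by L negates the second block column, left multiplication
    the second block row; hence P = - P and Q = - Q.\<close>
  have "four_block_mat G (- P) Q (- F) = four_block_mat G P (- Q) (- F)"
    using comm unfolding sb(5) grading_mat_def
    by (subst (asm) (1 2) mult_four_block_square[where n = n]) simp_all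
  note e = arg_cong[OF this, of "\<lambda>A. A $$ p" for p]
  have "P $$ (i,k) = 0" if "i < n" "k < n" for i k
    using e[of "(i, k + n)"] that carrier_matD[OF sb(1)] carrier_matD[OF sb(2)] carrier_matD[OF sb(4)] by simp
  then have P: "P = 0\<^sub>m n n" using carrier_matD[OF sb(2)] by (intro eq_matI) auto
  have "Q $$ (i,k) = 0" if "i < n" "k < n" for i k
    using e[of "(i + n, k)"] that carrier_matD[OF sb(1)] carrier_matD[OF sb(3)] carrier_matD[OF sb(4)] by simp
  then have Q: "Q = 0\<^sub>m n n" using carrier_matD[OF sb(3)] by (intro eq_matI) auto
  show ?thesis using that[OF sb(1) sb(4)] sb(5) P Q by simp
qed

text \<open>The upper right block of the symplectic condition reads G^T F = 1, and for square
  matrices this one-sided identity already makes F the inverse transpose of G.\<close>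

lemma symplectic_block_diag:
  assumes [simp]: "G \<in> carrier_mat n n" "F \<in> carrier_mat n n"
    and symp: "symplectic_mat n (four_block_mat G (0\<^sub>m n n) (0\<^sub>m n n) F)"
  shows "invertible_mat G" "F = transpose_mat (mat_inv G)"
proof -
  have [simp]: "transpose_mat G \<in> carrier_mat n n" "transpose_mat F \<in> carrier_mat n n" by simp_all
  have "four_block_mat (0\<^sub>m n n) (transpose_mat G * F) (- transpose_mat F * G) (0\<^sub>m n n) = symp_J n"
  proof -
    have "transpose_mat (four_block_mat G (0\<^sub>m n n) (0\<^sub>m n n) F) * symp_J n * four_block_mat G (0\<^sub>m n n) (0\<^sub>m n n) F
       = four_block_mat (0\<^sub>m n n) (transpose_mat G * F) (- transpose_mat F * G) (0\<^sub>m n n)"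
      unfolding symp_J_def
      by (subst transpose_four_block_mat[of _ n n _ n _ n], simp_all,
          subst mult_four_block_square[where n = n], simp_all,
          subst mult_four_block_square[where n = n], simp_all add: mult_carrier_mat[of _ n n _ n])
    then show ?thesis using symp by (simp add: symplectic_mat_def)
  qed
  note e = arg_cong[OF this, of "\<lambda>A. A $$ p" for p]
  have GF: "transpose_mat G * F = 1\<^sub>m n"
  proof (rule eq_matI)
    fix i k assume "i < dim_row (1\<^sub>m n)" "k < dim_col (1\<^sub>m n)"
    then show "(transpose_mat G * F) $$ (i,k) = 1\<^sub>m n $$ (i,k)"
      using e[of "(i, k + n)"] carrier_matD[OF assms(1)] carrier_matD[OF assms(2)] by (simp add: symp_J_def)
  qed (use carrier_matD[OF assms(1)] carrier_matD[OF assms(2)] in auto)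
  have FG: "transpose_mat F * G = 1\<^sub>m n"
    using arg_cong[OF GF, of transpose_mat] by (simp add: transpose_mult[of _ n n _ n])
  then have "G * transpose_mat F = 1\<^sub>m n"
    using mat_mult_left_right_inverse[of "transpose_mat F" n G] by simp
  with FG show inv: "invertible_mat G"
    unfolding invertible_mat_def inverts_mat_def
    using carrier_matD[OF assms(1)] carrier_matD[OF assms(2)] by auto
  note Gi = mat_inv_correct[OF assms(1) inv]
  have "transpose_mat F = transpose_mat F * (G * mat_inv G)" using Gi by simp
  also have "\<dots> = mat_inv G" using Gi(1) FG assoc_mult_mat[of "transpose_mat F" n n G n "mat_inv G" n] by simp
  finally show "F = transpose_mat (mat_inv G)" by (metis transpose_transpose)
qed

lemma hyp_decomp_exists:
  assumes S: "symplectic_mat n S"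
  shows "\<exists>U G \<theta>. hyp_decomp n S U G \<theta>"
proof -
  let ?m = "2 * n" and ?L = "grading_mat n"
  define M where "M = grading_conj n S"
  note props = grading_conj_props[OF S, folded M_def]
  obtain V \<theta> where V: "unitary_mat ?m V" "symplectic_mat n V"
    and MV: "M * V = V * (hyp_mat n (\<lambda>i. 2 * \<theta> i) * ?L)"
    using exists_unitary_symplectic_reduction[OF props(1,3,4)] by blast
  let ?A = "hyp_mat n \<theta>" and ?A' = "hyp_mat n (\<lambda>i. - \<theta> i)"
  have [simp]: "M \<in> carrier_mat ?m ?m" "V \<in> carrier_mat ?m ?m" "S \<in> carrier_mat ?m ?m"
    using props(1) V S by (auto simp: symplectic_mat_def)
  note VV = unitary_mat_inverse[OF V(1)]
  note [simp] = mult_carrier_mat[of _ ?m ?m _ ?m]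
  note assoc = assoc_mult_mat[of _ ?m ?m _ ?m _ ?m]
  define D where "D = ?A' * (mat_adjoint V * S)"
  have Dc [simp]: "D \<in> carrier_mat ?m ?m" by (simp add: D_def)
  have VM: "mat_adjoint V * M = hyp_mat n (\<lambda>i. 2 * \<theta> i) * ?L * mat_adjoint V"
  proof -
    have "mat_adjoint V * M = mat_adjoint V * (M * V) * mat_adjoint V" by (simp add: assoc VV)
    also have "\<dots> = (mat_adjoint V * V) * (hyp_mat n (\<lambda>i. 2 * \<theta> i) * ?L * mat_adjoint V)"
      unfolding MV by (simp add: assoc)
    finally show ?thesis by (simp add: VV)
  qed
  have AL: "?A' * (hyp_mat n (\<lambda>i. 2 * \<theta> i) * ?L) = ?L * ?A'"
  proof -
    have "?A' * (hyp_mat n (\<lambda>i. 2 * \<theta> i) * ?L) = (?A' * hyp_mat n (\<lambda>i. 2 * \<theta> i)) * ?L" by (simp add: assoc)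
    moreover have "?A' * hyp_mat n (\<lambda>i. 2 * \<theta> i) = ?A" by (simp add: hyp_mat_mult)
    ultimately show ?thesis by (simp add: grading_hyp_mat)
  qed
  \<comment> \<open>L moves from right to left through D by S L = M S, then V^* M = A^2 L V^*, and
    finally A^-1 A^2 L = A L = L A^-1.\<close>
  have "D * ?L = ?A' * (mat_adjoint V * (S * ?L))" by (simp add: D_def assoc)
  also have "\<dots> = ?A' * (mat_adjoint V * M) * S" unfolding props(2)[symmetric] by (simp add: assoc)
  also have "\<dots> = (?A' * (hyp_mat n (\<lambda>i. 2 * \<theta> i) * ?L)) * (mat_adjoint V * S)"
    unfolding VM by (simp add: assoc)
  also have "\<dots> = ?L * D" unfolding AL by (simp add: D_def assoc)
  finally obtain G F where GF: "G \<in> carrier_mat n n" "F \<in> carrier_mat n n"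
    and D: "D = four_block_mat G (0\<^sub>m n n) (0\<^sub>m n n) F"
    using commutes_grading_imp_block_diag[OF Dc] by blast
  have "symplectic_mat n ?A'" by (rule symplectic_hyp_mat)
  moreover have "symplectic_mat n (mat_adjoint V)" using symplectic_inverse[OF V(2) VV(2)] by simp
  ultimately have "symplectic_mat n D" unfolding D_def by (intro symplectic_mult S)
  then have G: "invertible_mat G" "F = transpose_mat (mat_inv G)"
    using symplectic_block_diag[OF GF] D by simp_all
  have "V * ?A * D = V * (?A * ?A') * mat_adjoint V * S" by (simp add: D_def assoc)
  then have "S = V * ?A * D" by (simp add: hyp_mat_inverse VV)
  then have "hyp_decomp n S V G \<theta>"
    unfolding hyp_decomp_def hyp_mat_def using V GF G D by simp
  then show ?thesis by blast
qed

theorem theorem6p6: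
  fixes n :: nat and S :: "complex mat"
  assumes "symplectic_mat n S"
  shows "\<exists>U G \<theta>. hyp_decomp n S U G \<theta> \<and>
           (\<forall>U' G' \<theta>'. hyp_decomp n S U' G' \<theta>' \<longrightarrow> eq_up_to_order_and_signs n \<theta> \<theta>')"
proof -
  obtain U G \<theta> where dec: "hyp_decomp n S U G \<theta>" using hyp_decomp_exists[OF assms] by blast
  then show ?thesis using hyp_decomp_unique[OF assms dec] by blast
qed

end
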